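(* Let $\Gamma$ be a finite simplicial graph and $\mathcal{G}$ a collection of groups indexed by $V(\Gamma)$. The electrification $\mathbb{E}(\Gamma,\mathcal{G})$ is (Gromov-)hyperbolic if and only if every induced square of $\Gamma$ is included in some minsquare subgraph of $\Gamma$.
   Context: Given a simplicial graph $\Gamma$ and a collection of groups $\mathcal{G}=\{G_u \mid u \in V(\Gamma)\}$, all assumed non-trivial (not necessarily finite), the graph product $\Gamma\mathcal{G}$ is the quotient of the free product $\ast_{u \in V(\Gamma)} G_u$ by the normal closure of the commutators $[g,h]$ with $g \in G_u$, $h\in G_v$, $(u,v) \in E(\Gamma)$. For an induced subgraph $\Lambda \subset \Gamma$, $\langle \Lambda \rangle$ denotes the subgroup of $\Gamma\mathcal{G}$ generated by the $G_u$, $u \in V(\Lambda)$. An induced square of $\Gamma$ is an induced subgraph which is a cycle of length four. A subgraph $\Lambda \leq \Gamma$ is square-complete if it is induced and if every induced square of $\Gamma$ containing two opposite (i.e. non-adjacent) vertices in $\Lambda$ is entirely included in $\Lambda$. A minsquare subgraph of $\Gamma$ is a subgraph which is minimal (for inclusion) among all the square-complete subgraphs of $\Gamma$ containing at least one induced square. The electrification $\mathbb{E}(\Gamma,\mathcal{G})$ is the Cayley graph of $\Gamma\mathcal{G}$ with respect to the generating set which is the union of the vertex-groups $G_u$, $u\in V(\Gamma)$, and of the subgroups $\langle\Lambda\rangle$ where $\Lambda$ is a minsquare subgraph of $\Gamma$. *)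

theory Defs
  imports Complex_Main "HOL-Algebra.Generated_Groups" "Graph_Theory.Graph_Theory"
begin

text \<open>
  A finite simplicial graph is a \<^locale>\<open>pair_graph\<close>: finitely many vertices, and a symmetric
  irreflexive set of arcs, an edge being a pair of opposite arcs.
\<close>

section \<open>Squares and minsquare subgraphs\<close>

definition four_cycle :: "'v pair_pre_digraph \<Rightarrow> bool" where
  "four_cycle S \<longleftrightarrow> (\<exists>a b c d. distinct [a, b, c, d] \<and> pverts S = {a, b, c, d} \<and>
     parcs S = {(a, b), (b, a), (b, c), (c, b), (c, d), (d, c), (d, a), (a, d)})"

definition induced_square :: "'v pair_pre_digraph \<Rightarrow> 'v pair_pre_digraph \<Rightarrow> bool" where
  "induced_square S \<Gamma> \<longleftrightarrow> induced_subgraph (with_proj S) (with_proj \<Gamma>) \<and> four_cycle S"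

definition square_complete :: "'v pair_pre_digraph \<Rightarrow> 'v pair_pre_digraph \<Rightarrow> bool" where
  "square_complete \<Lambda> \<Gamma> \<longleftrightarrow> induced_subgraph (with_proj \<Lambda>) (with_proj \<Gamma>) \<and>
     (\<forall>S x y. induced_square S \<Gamma> \<longrightarrow>
        x \<in> pverts S \<longrightarrow> y \<in> pverts S \<longrightarrow> x \<noteq> y \<longrightarrow> (x, y) \<notin> parcs S \<longrightarrow>
        x \<in> pverts \<Lambda> \<longrightarrow> y \<in> pverts \<Lambda> \<longrightarrow> subgraph (with_proj S) (with_proj \<Lambda>))"

definition square_complete_with_square ::
    "'v pair_pre_digraph \<Rightarrow> 'v pair_pre_digraph \<Rightarrow> bool" where
  "square_complete_with_square \<Lambda> \<Gamma> \<longleftrightarrow> square_complete \<Lambda> \<Gamma> \<and>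
     (\<exists>S. induced_square S \<Gamma> \<and> subgraph (with_proj S) (with_proj \<Lambda>))"

definition minsquare :: "'v pair_pre_digraph \<Rightarrow> 'v pair_pre_digraph \<Rightarrow> bool" where
  "minsquare \<Lambda> \<Gamma> \<longleftrightarrow> square_complete_with_square \<Lambda> \<Gamma> \<and>
     (\<forall>\<Lambda>'. square_complete_with_square \<Lambda>' \<Gamma> \<longrightarrow> subgraph (with_proj \<Lambda>') (with_proj \<Lambda>) \<longrightarrow>
        \<Lambda>' = \<Lambda>)"


section \<open>Free products and graph products\<close>

text \<open>
  The free product of the groups \<open>G u\<close>, \<open>u \<in> I\<close>: words whose letters are pairs \<open>(u, g)\<close> with
  \<open>g \<in> G u\<close>, modulo the congruence that deletes a letter \<open>(u, 1)\<close> and multiplies two adjacent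
  letters of the same group.
\<close>

definition fp_words :: "'v set \<Rightarrow> ('v \<Rightarrow> ('g, 'm) monoid_scheme) \<Rightarrow> ('v \<times> 'g) list set" where
  "fp_words I G = lists (SIGMA u:I. carrier (G u))"

inductive_set fp_rel ::
    "'v set \<Rightarrow> ('v \<Rightarrow> ('g, 'm) monoid_scheme) \<Rightarrow> (('v \<times> 'g) list \<times> ('v \<times> 'g) list) set"
  for I G where
  fp_refl: "w \<in> fp_words I G \<Longrightarrow> (w, w) \<in> fp_rel I G"
| fp_sym: "(w, w') \<in> fp_rel I G \<Longrightarrow> (w', w) \<in> fp_rel I G"
| fp_trans: "(w, w') \<in> fp_rel I G \<Longrightarrow> (w', w'') \<in> fp_rel I G \<Longrightarrow> (w, w'') \<in> fp_rel I G"
| fp_one: "x \<in> fp_words I G \<Longrightarrow> y \<in> fp_words I G \<Longrightarrow> u \<in> I \<Longrightarrow>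
    (x @ [(u, \<one>\<^bsub>G u\<^esub>)] @ y, x @ y) \<in> fp_rel I G"
| fp_mult: "x \<in> fp_words I G \<Longrightarrow> y \<in> fp_words I G \<Longrightarrow> u \<in> I \<Longrightarrow>
    g \<in> carrier (G u) \<Longrightarrow> h \<in> carrier (G u) \<Longrightarrow>
    (x @ [(u, g), (u, h)] @ y, x @ [(u, g \<otimes>\<^bsub>G u\<^esub> h)] @ y) \<in> fp_rel I G"

definition free_product ::
    "'v set \<Rightarrow> ('v \<Rightarrow> ('g, 'm) monoid_scheme) \<Rightarrow> ('v \<times> 'g) list set monoid" where
  "free_product I G =
     \<lparr>carrier = fp_words I G // fp_rel I G,
      monoid.mult = (\<lambda>A B. fp_rel I G `` {x @ y | x y. x \<in> A \<and> y \<in> B}),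
      one = fp_rel I G `` {[]}\<rparr>"

definition fp_incl ::
    "'v set \<Rightarrow> ('v \<Rightarrow> ('g, 'm) monoid_scheme) \<Rightarrow> 'v \<Rightarrow> 'g \<Rightarrow> ('v \<times> 'g) list set" where
  "fp_incl I G u g = fp_rel I G `` {[(u, g)]}"

definition normal_closure :: "('a, 'b) monoid_scheme \<Rightarrow> 'a set \<Rightarrow> 'a set" where
  "normal_closure F R = \<Inter>{N. N \<lhd> F \<and> R \<subseteq> N}"

definition gp_relators ::
    "'v pair_pre_digraph \<Rightarrow> ('v \<Rightarrow> ('g, 'm) monoid_scheme) \<Rightarrow> ('v \<times> 'g) list set set" where
  "gp_relators \<Gamma> G =
     (let F = free_product (pverts \<Gamma>) G; \<iota> = fp_incl (pverts \<Gamma>) G in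
      {\<iota> u g \<otimes>\<^bsub>F\<^esub> \<iota> v h \<otimes>\<^bsub>F\<^esub> inv\<^bsub>F\<^esub> (\<iota> u g) \<otimes>\<^bsub>F\<^esub> inv\<^bsub>F\<^esub> (\<iota> v h) | u v g h.
         (u, v) \<in> parcs \<Gamma> \<and> g \<in> carrier (G u) \<and> h \<in> carrier (G v)})"

definition graph_product ::
    "'v pair_pre_digraph \<Rightarrow> ('v \<Rightarrow> ('g, 'm) monoid_scheme) \<Rightarrow> ('v \<times> 'g) list set set monoid" where
  "graph_product \<Gamma> G =
     (let F = free_product (pverts \<Gamma>) G in F Mod normal_closure F (gp_relators \<Gamma> G))"

text \<open>This is the image of \<open>G u\<close> in the graph product.\<close>

definition vertex_group ::
    "'v pair_pre_digraph \<Rightarrow> ('v \<Rightarrow> ('g, 'm) monoid_scheme) \<Rightarrow> 'v \<Rightarrow> ('v \<times> 'g) list set set set" where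
  "vertex_group \<Gamma> G u =
     (let F = free_product (pverts \<Gamma>) G in
      (\<lambda>g. normal_closure F (gp_relators \<Gamma> G) #>\<^bsub>F\<^esub> fp_incl (pverts \<Gamma>) G u g) ` carrier (G u))"

definition gp_subgroup ::
    "'v pair_pre_digraph \<Rightarrow> ('v \<Rightarrow> ('g, 'm) monoid_scheme) \<Rightarrow> 'v pair_pre_digraph \<Rightarrow>
     ('v \<times> 'g) list set set set" where
  "gp_subgroup \<Gamma> G \<Lambda> = generate (graph_product \<Gamma> G) (\<Union>u\<in>pverts \<Lambda>. vertex_group \<Gamma> G u)"


section \<open>Cayley graphs and the electrification\<close>

definition cayley_graph :: "('a, 'b) monoid_scheme \<Rightarrow> 'a set \<Rightarrow> 'a pair_pre_digraph" where
  "cayley_graph H S =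
     \<lparr>pverts = carrier H,
      parcs = {(g, h). g \<in> carrier H \<and> h \<in> carrier H \<and> g \<noteq> h \<and>
                 (\<exists>s\<in>S. h = g \<otimes>\<^bsub>H\<^esub> s \<or> g = h \<otimes>\<^bsub>H\<^esub> s)}\<rparr>"

definition electrification ::
    "'v pair_pre_digraph \<Rightarrow> ('v \<Rightarrow> ('g, 'm) monoid_scheme) \<Rightarrow>
     ('v \<times> 'g) list set set pair_pre_digraph" where
  "electrification \<Gamma> G =
     cayley_graph (graph_product \<Gamma> G)
       ((\<Union>u\<in>pverts \<Gamma>. vertex_group \<Gamma> G u) \<union> (\<Union>\<Lambda>\<in>{\<Lambda>. minsquare \<Lambda> \<Gamma>}. gp_subgroup \<Gamma> G \<Lambda>))"


section \<open>Gromov hyperbolicity\<close>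

definition gromov_product :: "('a \<Rightarrow> 'a \<Rightarrow> real) \<Rightarrow> 'a \<Rightarrow> 'a \<Rightarrow> 'a \<Rightarrow> real" where
  "gromov_product d w x y = (d x w + d y w - d x y) / 2"

definition gromov_hyperbolic :: "'a set \<Rightarrow> ('a \<Rightarrow> 'a \<Rightarrow> real) \<Rightarrow> bool" where
  "gromov_hyperbolic M d \<longleftrightarrow>
     (\<exists>\<delta>. \<forall>w\<in>M. \<forall>x\<in>M. \<forall>y\<in>M. \<forall>z\<in>M.
        gromov_product d w x z \<ge> min (gromov_product d w x y) (gromov_product d w y z) - \<delta>)"

text \<open>
  The distance of a connected graph, the least number of arcs of a walk. On a disconnected graph
  \<open>graph_dist\<close> would take the junk value \<open>0\<close> between components; Cayley graphs of generating sets
  are connected.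
\<close>

definition graph_dist :: "'a pair_pre_digraph \<Rightarrow> 'a \<Rightarrow> 'a \<Rightarrow> real" where
  "graph_dist X x y = real_of_ereal (wf_digraph.\<mu> (with_proj X) (\<lambda>_. 1) x y)"

text \<open>
  A connected graph is hyperbolic if its vertex set is, for the graph distance. The vertices are
  \<open>1/2\<close>-dense in the geometric realization, on which the four-point condition then holds as well,
  with another \<open>\<delta>\<close>.
\<close>

definition hyperbolic_graph :: "'a pair_pre_digraph \<Rightarrow> bool" where
  "hyperbolic_graph X \<longleftrightarrow> gromov_hyperbolic (pverts X) (graph_dist X)"

end

theory Submission
  imports Defs
begin

text \<open>
  Write \<open>\<sigma> u x\<close> for the syllable of \<open>x\<close> in the vertex group of \<open>u\<close> that can be shuffled to the
  front of its normal form, and \<open>\<sigma> u x = 1\<close> if there is none. The walls of the graph product are the maps \<open>z \<mapsto> \<sigma> u (k z)\<close>; the labels \<open>u\<close> of the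
  walls separating \<open>x\<close> from \<open>y\<close> generate the smallest \<open>\<langle>\<Lambda>\<rangle>\<close> containing \<open>x\<inverse>y\<close>. Two walls
  either have adjacent labels or are nested, and the group, seen as a set of functions on the walls,
  is closed under the dual discriminator (the gate of quasi-median graphs). The labels of the two
  sides of a rectangle form a join. If every induced square lies in a minsquare subgraph, one side of
  each rectangle is therefore short in the electrification. Projecting an electrified geodesic onto
  intervals then shows that the electrified distance is additive along intervals up to a constant,
  so that Gromov products are distances to medians, and the four-point condition follows.

  Conversely, let \<open>a, b, c, d\<close> be an induced square in no minsquare subgraph. No minsquare subgraph
  contains two opposite vertices of it, so a step in the electrification crosses at most one wall of
  the chain labelled \<open>a, c, a, c, \<dots>\<close> that the powers of \<open>\<alpha>\<gamma>\<close> cross, and similarly for \<open>b, d\<close>.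
  The powers of \<open>\<alpha>\<gamma>\<close> and \<open>\<beta>\<epsilon>\<close> then span a flat that contradicts the four-point condition.
\<close>

section \<open>Normal forms in graph products\<close>

locale graph_product_words =
  fixes \<Gamma> :: "'v pair_pre_digraph" and G :: "'v \<Rightarrow> ('g, 'm) monoid_scheme"
  assumes pair_graph: "pair_graph \<Gamma>"
    and group_G: "\<And>u. u \<in> pverts \<Gamma> \<Longrightarrow> group (G u)"
begin

section \<open>Heads of words, reduced words and shuffling\<close>

abbreviation adj :: "'v \<Rightarrow> 'v \<Rightarrow> bool" where
  "adj u v \<equiv> (u, v) \<in> parcs \<Gamma>"

lemma adj_sym: "adj u v \<Longrightarrow> adj v u"
proof -
  interpret pair_graph \<Gamma> by (rule pair_graph)
  show "adj u v \<Longrightarrow> adj v u" by (rule arcs_symmetric)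
qed

lemma adj_irrefl: "\<not> adj u u"
proof -
  interpret pair_graph \<Gamma> by (rule pair_graph)
  show ?thesis using no_loops' by blast
qed

lemma adj_verts: "adj u v \<Longrightarrow> u \<in> pverts \<Gamma>" "adj u v \<Longrightarrow> v \<in> pverts \<Gamma>"
proof -
  interpret pair_graph \<Gamma> by (rule pair_graph)
  show "adj u v \<Longrightarrow> u \<in> pverts \<Gamma>" "adj u v \<Longrightarrow> v \<in> pverts \<Gamma>"
    using in_arcsD1 in_arcsD2 by blast+
qed

lemma finite_verts: "finite (pverts \<Gamma>)"
proof -
  interpret pair_graph \<Gamma> by (rule pair_graph)
  show ?thesis by (rule pair_finite_verts)
qed

text \<open>The scan passes letters adjacent to \<open>u\<close>, since they commute with it. The
  default \<open>\<one>\<close> stands both for a blocking letter and for the end of the word, so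
  heads can be multiplied without case distinctions.\<close>

primrec vhead :: "'v \<Rightarrow> ('v \<times> 'g) list \<Rightarrow> 'g" where
  "vhead u [] = \<one>\<^bsub>G u\<^esub>"
| "vhead u (p # w) =
    (if fst p = u then snd p else if adj (fst p) u then vhead u w else \<one>\<^bsub>G u\<^esub>)"

primrec vrem :: "'v \<Rightarrow> ('v \<times> 'g) list \<Rightarrow> ('v \<times> 'g) list" where
  "vrem u [] = []"
| "vrem u (p # w) = (if fst p = u then w else if adj (fst p) u then p # vrem u w else p # w)"

text \<open>The new letter is merged with the head it can reach. Dropping a trivial result is what
  keeps the word reduced.\<close>

definition lmul :: "'v \<Rightarrow> 'g \<Rightarrow> ('v \<times> 'g) list \<Rightarrow> ('v \<times> 'g) list" where
  "lmul u a w = (let c = a \<otimes>\<^bsub>G u\<^esub> vhead u w in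
     if c = \<one>\<^bsub>G u\<^esub> then vrem u w else (u, c) # vrem u w)"

text \<open>Trivial heads are required in every suffix, so two syllables of one vertex group can
  never be shuffled together: these are the normal forms of graph products.\<close>

primrec reduced :: "('v \<times> 'g) list \<Rightarrow> bool" where
  "reduced [] \<longleftrightarrow> True"
| "reduced (p # w) \<longleftrightarrow> fst p \<in> pverts \<Gamma> \<and> snd p \<in> carrier (G (fst p)) \<and>
     snd p \<noteq> \<one>\<^bsub>G (fst p)\<^esub> \<and> vhead (fst p) w = \<one>\<^bsub>G (fst p)\<^esub> \<and> reduced w"

text \<open>Normal forms are unique only up to exchanging adjacent commuting letters, so the action
  below is well defined modulo this relation, not on lists.\<close>

inductive shuffle :: "('v \<times> 'g) list \<Rightarrow> ('v \<times> 'g) list \<Rightarrow> bool" (infix \<open>\<approx>\<close> 50) where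
  refl: "w \<approx> w"
| swap: "adj u v \<Longrightarrow> (u, a) # (v, b) # w \<approx> (v, b) # (u, a) # w"
| cons: "w \<approx> w' \<Longrightarrow> p # w \<approx> p # w'"
| trans: "w \<approx> w' \<Longrightarrow> w' \<approx> w'' \<Longrightarrow> w \<approx> w''"

lemma shuffle_sym: "w \<approx> w' \<Longrightarrow> w' \<approx> w"
  by (induction rule: shuffle.induct) (blast intro: shuffle.intros adj_sym)+

lemma shuffle_length: "w \<approx> w' \<Longrightarrow> length w = length w'"
  by (induction rule: shuffle.induct) auto

lemma shuffle_vhead: "w \<approx> w' \<Longrightarrow> vhead t w = vhead t w'"
  by (induction rule: shuffle.induct) (auto simp: adj_irrefl dest: adj_sym)

lemma shuffle_vrem: "w \<approx> w' \<Longrightarrow> vrem t w \<approx> vrem t w'"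
  by (induction rule: shuffle.induct)
    (auto simp: adj_irrefl dest: adj_sym intro: shuffle.intros)

lemma shuffle_lmul: "w \<approx> w' \<Longrightarrow> lmul u a w \<approx> lmul u a w'"
  by (auto simp: lmul_def Let_def shuffle_vhead intro: shuffle_vrem shuffle.cons)

lemma vhead_vrem_adj: "adj u v \<Longrightarrow> vhead u (vrem v w) = vhead u w"
  by (induction w) (auto simp: adj_irrefl dest: adj_sym)

lemma vrem_vrem_adj: "adj u v \<Longrightarrow> vrem u (vrem v w) = vrem v (vrem u w)"
  by (induction w) (auto simp: adj_irrefl dest: adj_sym)

lemma vhead_vrem: "reduced w \<Longrightarrow> vhead u (vrem u w) = \<one>\<^bsub>G u\<^esub>"
  by (induction w) auto

lemma reduced_vrem: "reduced w \<Longrightarrow> reduced (vrem u w)"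
  by (induction w) (auto simp: vhead_vrem_adj)

lemma vrem_trivial: "reduced w \<Longrightarrow> vhead u w = \<one>\<^bsub>G u\<^esub> \<Longrightarrow> vrem u w = w"
  by (induction w) (auto split: if_splits)

lemma vrem_vrem: "reduced w \<Longrightarrow> vrem u (vrem u w) = vrem u w"
  by (simp add: vrem_trivial vhead_vrem reduced_vrem)

lemma shuffle_head_first:
  "vhead u w \<noteq> \<one>\<^bsub>G u\<^esub> \<Longrightarrow> w \<approx> (u, vhead u w) # vrem u w"
proof (induction w)
  case (Cons p w)
  show ?case
  proof (cases "fst p = u")
    case True
    then show ?thesis by (cases p) (auto intro: shuffle.refl)
  next
    case False
    then have a: "adj (fst p) u" "vhead u w \<noteq> \<one>\<^bsub>G u\<^esub>"
      using Cons.prems by (auto split: if_splits)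
    then have "p # w \<approx> p # (u, vhead u w) # vrem u w"
      using Cons.IH by (blast intro: shuffle.cons)
    also have "p # (u, vhead u w) # vrem u w \<approx> (u, vhead u w) # p # vrem u w"
      using a shuffle.swap[of "fst p" u "snd p"] by simp
    finally (shuffle.trans) show ?thesis using a False by simp
  qed
qed simp

lemma vhead_closed: "u \<in> pverts \<Gamma> \<Longrightarrow> reduced w \<Longrightarrow> vhead u w \<in> carrier (G u)"
  by (induction w) (auto simp: group.is_monoid group_G)

lemma vhead_lmul:
  assumes "u \<in> pverts \<Gamma>" "a \<in> carrier (G u)" "reduced w"
  shows "vhead u (lmul u a w) = a \<otimes>\<^bsub>G u\<^esub> vhead u w"
  using assms by (auto simp: lmul_def Let_def vhead_vrem)

lemma reduced_lmul:
  assumes "u \<in> pverts \<Gamma>" "a \<in> carrier (G u)" "reduced w"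
  shows "reduced (lmul u a w)"
proof -
  interpret group "G u" using assms(1) by (rule group_G)
  show ?thesis using assms
    by (auto simp: lmul_def Let_def vhead_vrem reduced_vrem vhead_closed)
qed

text \<open>Only up to shuffling, because a nontrivial head is brought to the front of the
  list.\<close>

lemma lmul_one:
  assumes "u \<in> pverts \<Gamma>" "reduced w"
  shows "lmul u \<one>\<^bsub>G u\<^esub> w \<approx> w"
proof -
  interpret group "G u" using assms(1) by (rule group_G)
  show ?thesis using assms shuffle_sym[OF shuffle_head_first]
    by (auto simp: lmul_def Let_def vhead_closed vrem_trivial intro: shuffle.refl)
qed

lemma lmul_mult:
  assumes "u \<in> pverts \<Gamma>" "a \<in> carrier (G u)" "b \<in> carrier (G u)" "reduced w"
  shows "lmul u a (lmul u b w) = lmul u (a \<otimes>\<^bsub>G u\<^esub> b) w"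
proof -
  interpret group "G u" using assms(1) by (rule group_G)
  have r: "vrem u (lmul u b w) = vrem u w"
    using assms by (auto simp: lmul_def Let_def vrem_vrem)
  show ?thesis
    unfolding lmul_def[of u a] lmul_def[of u "a \<otimes>\<^bsub>G u\<^esub> b"] r
    using assms by (simp add: vhead_lmul m_assoc vhead_closed)
qed

lemma vhead_lmul_adj: "adj u v \<Longrightarrow> vhead u (lmul v b w) = vhead u w"
  by (auto simp: lmul_def Let_def vhead_vrem_adj adj_irrefl dest: adj_sym)

lemma vrem_lmul_adj: "adj u v \<Longrightarrow> vrem u (lmul v b w) = lmul v b (vrem u w)"
  using vrem_vrem_adj[of u v w] vhead_vrem_adj[of v u w]
  by (auto simp: lmul_def Let_def adj_irrefl dest: adj_sym)

lemma lmul_commute: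
  assumes "adj u v"
  shows "lmul u a (lmul v b w) \<approx> lmul v b (lmul u a w)"
proof -
  have "vhead v (vrem u w) = vhead v w" "vhead u (vrem v w) = vhead u w" "adj v u"
      "vrem v (vrem u w) = vrem u (vrem v w)"
    using assms by (simp_all add: vhead_vrem_adj vrem_vrem_adj adj_sym)
  then show ?thesis
    unfolding lmul_def[of u a] vhead_lmul_adj[OF assms] vrem_lmul_adj[OF assms]
    using assms by (auto simp: lmul_def Let_def adj_irrefl intro: shuffle.intros)
qed

text \<open>Van der Waerden's method: words act on reduced words by left multiplication, and
  uniqueness of normal forms follows from checking the defining relations on this action.\<close>

definition act :: "('v \<times> 'g) list \<Rightarrow> ('v \<times> 'g) list \<Rightarrow> ('v \<times> 'g) list" where
  "act x w = foldr (\<lambda>p. lmul (fst p) (snd p)) x w"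

lemma act_simps [simp]:
  "act [] w = w" "act (p # x) w = lmul (fst p) (snd p) (act x w)"
  "act (x @ y) w = act x (act y w)"
  by (simp_all add: act_def)

abbreviation words :: "('v \<times> 'g) list set" where
  "words \<equiv> fp_words (pverts \<Gamma>) G"

lemma words_simps [simp]:
  "[] \<in> words"
  "p # w \<in> words \<longleftrightarrow> fst p \<in> pverts \<Gamma> \<and> snd p \<in> carrier (G (fst p)) \<and> w \<in> words"
  "x @ y \<in> words \<longleftrightarrow> x \<in> words \<and> y \<in> words"
  by (cases p; auto simp: fp_words_def)+

lemma reduced_act: "x \<in> words \<Longrightarrow> reduced w \<Longrightarrow> reduced (act x w)"
  by (induction x) (auto simp: reduced_lmul)

lemma reduced_words: "reduced w \<Longrightarrow> w \<in> words"
  by (induction w) auto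

lemma shuffle_act: "w \<approx> w' \<Longrightarrow> act x w \<approx> act x w'"
  by (induction x) (auto simp: shuffle_lmul)

text \<open>No letter of a reduced word finds a head to merge with, so the word is rebuilt unchanged
  from \<open>[]\<close>. This is how the action recovers normal forms.\<close>

lemma act_reduced: "reduced w \<Longrightarrow> act w [] = w"
proof (induction w)
  case (Cons p w)
  obtain u a where p: "p = (u, a)" by (cases p)
  with Cons.prems interpret group "G u" using group_G by auto
  show ?case using Cons p by (auto simp: lmul_def vrem_trivial Let_def)
qed simp

lemma length_vrem_le: "length (vrem u w) \<le> length w"
  by (induction w) auto

lemma length_lmul: "length (lmul u a w) \<le> Suc (length w)"
  using length_vrem_le[of u w] by (auto simp: lmul_def Let_def)

lemma length_act: "length (act x []) \<le> length x"
proof (induction x)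
  case (Cons p x)
  then show ?case using length_lmul[of "fst p" "snd p" "act x []"] by simp
qed simp


section \<open>The free product as words modulo a congruence\<close>

abbreviation rel where "rel \<equiv> fp_rel (pverts \<Gamma>) G"
abbreviation cls where "cls x \<equiv> fp_rel (pverts \<Gamma>) G `` {x}"
abbreviation F where "F \<equiv> free_product (pverts \<Gamma>) G"
abbreviation N where "N \<equiv> normal_closure F (gp_relators \<Gamma> G)"
abbreviation P where "P \<equiv> graph_product \<Gamma> G"

lemma rel_words: "(x, y) \<in> rel \<Longrightarrow> x \<in> words \<and> y \<in> words"
proof (induction rule: fp_rel.induct)
  case (fp_one x y u)
  then interpret group "G u" by (simp add: group_G)
  show ?case using fp_one by simp
next
  case (fp_mult x y u g h)
  then interpret group "G u" by (simp add: group_G)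
  show ?case using fp_mult by simp
qed auto

lemma equiv_rel: "equiv words rel"
  by (rule equivI) (auto simp: refl_on_def sym_def trans_def dest: rel_words intro: fp_rel.intros)

lemma rel_append_left:
  assumes "z \<in> words" "(x, y) \<in> rel" shows "(z @ x, z @ y) \<in> rel"
  using assms(2)
proof (induction rule: fp_rel.induct)
  case (fp_one x y u)
  then show ?case using fp_rel.fp_one[of "z @ x" "pverts \<Gamma>" G y u] assms(1) by simp
next
  case (fp_mult x y u g h)
  then show ?case using fp_rel.fp_mult[of "z @ x" "pverts \<Gamma>" G y u g h] assms(1) by simp
qed (use assms(1) in \<open>auto intro: fp_rel.intros\<close>)

lemma rel_append_right:
  assumes "z \<in> words" "(x, y) \<in> rel" shows "(x @ z, y @ z) \<in> rel"
  using assms(2)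
proof (induction rule: fp_rel.induct)
  case (fp_one x y u)
  then show ?case using fp_rel.fp_one[of x "pverts \<Gamma>" G "y @ z" u] assms(1) by simp
next
  case (fp_mult x y u g h)
  then show ?case using fp_rel.fp_mult[of x "pverts \<Gamma>" G "y @ z" u g h] assms(1) by simp
qed (use assms(1) in \<open>auto intro: fp_rel.intros\<close>)

lemma rel_append: "(x, x') \<in> rel \<Longrightarrow> (y, y') \<in> rel \<Longrightarrow> (x @ y, x' @ y') \<in> rel"
  by (meson fp_trans rel_append_left rel_append_right rel_words)

lemma cls_eq_iff: "x \<in> words \<Longrightarrow> y \<in> words \<Longrightarrow> cls x = cls y \<longleftrightarrow> (x, y) \<in> rel"
  by (rule eq_equiv_class_iff[OF equiv_rel])

lemma self_cls: "x \<in> words \<Longrightarrow> x \<in> cls x"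
  by (rule equiv_class_self[OF equiv_rel])

lemma carrier_F: "carrier F = cls ` words"
  by (auto simp: free_product_def quotient_def)

lemma cls_carrier [simp]: "x \<in> words \<Longrightarrow> cls x \<in> carrier F"
  by (simp add: carrier_F)

lemma one_F: "\<one>\<^bsub>F\<^esub> = cls []"
  by (simp add: free_product_def)

lemma mult_cls:
  assumes "x \<in> words" "y \<in> words"
  shows "cls x \<otimes>\<^bsub>F\<^esub> cls y = cls (x @ y)"
proof -
  have "rel `` {x' @ y' |x' y'. x' \<in> cls x \<and> y' \<in> cls y} = cls (x @ y)" (is "?L = _")
  proof
    show "?L \<subseteq> cls (x @ y)" by (auto intro: fp_trans rel_append)
    show "cls (x @ y) \<subseteq> ?L" using assms[THEN self_cls] by blast
  qed
  then show ?thesis by (simp add: free_product_def)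
qed

definition inv_word :: "('v \<times> 'g) list \<Rightarrow> ('v \<times> 'g) list" where
  "inv_word x = rev (map (\<lambda>(u, a). (u, inv\<^bsub>G u\<^esub> a)) x)"

lemma length_inv_word [simp]: "length (inv_word x) = length x"
  by (simp add: inv_word_def)

lemma inv_word_words [simp]: "x \<in> words \<Longrightarrow> inv_word x \<in> words"
  by (induction x) (auto simp: inv_word_def group.inv_closed group_G)

lemma inv_word_left: "x \<in> words \<Longrightarrow> (inv_word x @ x, []) \<in> rel"
proof (induction x)
  case Nil
  then show ?case by (simp add: inv_word_def fp_refl)
next
  case (Cons p x)
  obtain u a where p: "p = (u, a)" by (cases p)
  with Cons.prems have u: "u \<in> pverts \<Gamma>" "a \<in> carrier (G u)" "x \<in> words" by auto
  interpret group "G u" using u by (simp add: group_G)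
  let ?i = "inv_word x"
  have "(?i @ [(u, inv\<^bsub>G u\<^esub> a), (u, a)] @ x, ?i @ [(u, inv\<^bsub>G u\<^esub> a \<otimes>\<^bsub>G u\<^esub> a)] @ x) \<in> rel"
    by (rule fp_mult) (use u in auto)
  also have "inv\<^bsub>G u\<^esub> a \<otimes>\<^bsub>G u\<^esub> a = \<one>\<^bsub>G u\<^esub>" using u by simp
  finally have 1: "(?i @ [(u, inv\<^bsub>G u\<^esub> a), (u, a)] @ x, ?i @ [(u, \<one>\<^bsub>G u\<^esub>)] @ x) \<in> rel" .
  have 2: "(?i @ [(u, \<one>\<^bsub>G u\<^esub>)] @ x, ?i @ x) \<in> rel"
    by (rule fp_one) (use u in auto)
  show ?case using fp_trans[OF fp_trans[OF 1 2] Cons.IH] u p by (simp add: inv_word_def)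
qed

lemma group_F: "group F"
proof (rule groupI)
  fix X assume "X \<in> carrier F"
  then obtain x where x: "x \<in> words" "X = cls x" by (auto simp: carrier_F)
  then have "cls (inv_word x) \<otimes>\<^bsub>F\<^esub> X = \<one>\<^bsub>F\<^esub>"
    using inv_word_left[of x] by (simp add: mult_cls one_F cls_eq_iff)
  then show "\<exists>Y\<in>carrier F. Y \<otimes>\<^bsub>F\<^esub> X = \<one>\<^bsub>F\<^esub>" using x by fastforce
qed (auto simp: carrier_F mult_cls one_F)

lemma inv_cls: "x \<in> words \<Longrightarrow> inv\<^bsub>F\<^esub> (cls x) = cls (inv_word x)"
  by (rule group.inv_equality[OF group_F])
    (use inv_word_left[of x] in \<open>simp_all add: mult_cls one_F cls_eq_iff\<close>)

section \<open>Descent of the action to the graph product\<close>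

lemma normal_normal_closure:
  assumes "group H" "R \<subseteq> carrier H"
  shows "normal_closure H R \<lhd> H"
proof -
  interpret group H by (rule assms)
  let ?S = "{N. N \<lhd> H \<and> R \<subseteq> N}"
  have c: "carrier H \<in> ?S" using assms(2) by (simp add: normal_invI subgroup_self)
  have "subgroup (\<Inter>?S) H"
    using c by (intro subgroups_Inter) (auto simp: normal_imp_subgroup)
  moreover have "x \<otimes>\<^bsub>H\<^esub> h \<otimes>\<^bsub>H\<^esub> inv\<^bsub>H\<^esub> x \<in> \<Inter>?S" if "x \<in> carrier H" "h \<in> \<Inter>?S" for x h
    using that by (auto intro: normal.inv_op_closed2)
  ultimately show ?thesis unfolding normal_closure_def by (rule normal_invI)
qed

lemma act_rel:
  "(x, y) \<in> rel \<Longrightarrow> reduced w \<Longrightarrow> act x w \<approx> act y w"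
proof (induction rule: fp_rel.induct)
  case (fp_one x y u)
  then show ?case by (simp add: shuffle_act lmul_one reduced_act)
next
  case (fp_mult x y u g h)
  then show ?case by (simp add: lmul_mult reduced_act shuffle.refl)
qed (auto intro: shuffle.refl shuffle_sym shuffle.trans)

text \<open>The kernel of the action on reduced words modulo shuffling. It is normal and contains
  the relators, hence contains \<open>N\<close>.\<close>

definition acts_trivially :: "('v \<times> 'g) list set set" where
  "acts_trivially = {cls x |x. x \<in> words \<and> (\<forall>w. reduced w \<longrightarrow> act x w \<approx> w)}"

lemma cls_acts_trivially:
  assumes "x \<in> words"
  shows "cls x \<in> acts_trivially \<longleftrightarrow> (\<forall>w. reduced w \<longrightarrow> act x w \<approx> w)"
proof
  assume "cls x \<in> acts_trivially"
  then obtain y where "y \<in> words" "cls x = cls y" "\<And>w. reduced w \<Longrightarrow> act y w \<approx> w"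
    unfolding acts_trivially_def by blast
  then show "\<forall>w. reduced w \<longrightarrow> act x w \<approx> w"
    using assms act_rel by (metis cls_eq_iff shuffle.trans)
qed (use assms in \<open>auto simp: acts_trivially_def\<close>)

lemma act_inv_word:
  assumes "x \<in> words" "reduced w"
  shows "act (inv_word x) (act x w) \<approx> w" "act x (act (inv_word x) w) \<approx> w"
proof -
  show "act (inv_word x) (act x w) \<approx> w"
    using act_rel[OF inv_word_left[OF assms(1)] assms(2)] by simp
  interpret group F by (rule group_F)
  have "cls (x @ inv_word x) = cls []"
    using r_inv[of "cls x"] assms(1) by (simp add: inv_cls mult_cls one_F)
  then have "(x @ inv_word x, []) \<in> rel" using assms(1) by (simp add: cls_eq_iff)
  from act_rel[OF this assms(2)] show "act x (act (inv_word x) w) \<approx> w" by simp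
qed

lemma normal_acts_trivially: "acts_trivially \<lhd> F"
proof -
  interpret group F by (rule group_F)
  have "subgroup acts_trivially F"
  proof (rule subgroupI)
    show "acts_trivially \<subseteq> carrier F" by (auto simp: acts_trivially_def)
    have "cls [] \<in> acts_trivially" by (simp add: cls_acts_trivially shuffle.refl)
    then show "acts_trivially \<noteq> {}" by auto
  next
    fix A assume "A \<in> acts_trivially"
    then obtain x where x: "x \<in> words" "A = cls x" "\<And>w. reduced w \<Longrightarrow> act x w \<approx> w"
      unfolding acts_trivially_def by blast
    have "act (inv_word x) w \<approx> w" if "reduced w" for w
      using shuffle_act[OF x(3)[OF that], of "inv_word x"] act_inv_word(1)[OF x(1) that]
      by (meson shuffle.trans shuffle_sym)
    then show "inv\<^bsub>F\<^esub> A \<in> acts_trivially" using x by (simp add: inv_cls cls_acts_trivially)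
  next
    fix A B assume "A \<in> acts_trivially" "B \<in> acts_trivially"
    then obtain x y where x: "x \<in> words" "A = cls x" "\<And>w. reduced w \<Longrightarrow> act x w \<approx> w"
      and y: "y \<in> words" "B = cls y" "\<And>w. reduced w \<Longrightarrow> act y w \<approx> w"
      unfolding acts_trivially_def by blast
    have "act x (act y w) \<approx> w" if "reduced w" for w
      using shuffle.trans[OF shuffle_act[OF y(3)[OF that]] x(3)[OF that]] .
    then show "A \<otimes>\<^bsub>F\<^esub> B \<in> acts_trivially" using x y by (simp add: mult_cls cls_acts_trivially)
  qed
  moreover have "X \<otimes>\<^bsub>F\<^esub> A \<otimes>\<^bsub>F\<^esub> inv\<^bsub>F\<^esub> X \<in> acts_trivially"
    if X: "X \<in> carrier F" and "A \<in> acts_trivially" for X A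
  proof -
    obtain x where x: "x \<in> words" "A = cls x" "\<And>w. reduced w \<Longrightarrow> act x w \<approx> w"
      using \<open>A \<in> acts_trivially\<close> unfolding acts_trivially_def by blast
    obtain y where y: "y \<in> words" "X = cls y" using X by (auto simp: carrier_F)
    have "act y (act x (act (inv_word y) w)) \<approx> w" if "reduced w" for w
      using shuffle_act[OF x(3)[of "act (inv_word y) w"]] act_inv_word(2)[OF y(1) that] that y(1)
      by (meson shuffle.trans reduced_act inv_word_words)
    then show ?thesis using x y by (simp add: inv_cls mult_cls cls_acts_trivially)
  qed
  ultimately show ?thesis by (rule normal_invI)
qed

lemma fp_incl_cls: "fp_incl (pverts \<Gamma>) G u a = cls [(u, a)]"
  by (simp add: fp_incl_def)

lemma gp_relators_eq:
  "gp_relators \<Gamma> G = {cls ([(u, a), (v, b)] @ inv_word [(u, a)] @ inv_word [(v, b)]) | u v a b.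
     adj u v \<and> a \<in> carrier (G u) \<and> b \<in> carrier (G v)}"
proof -
  have "cls [(u, a)] \<otimes>\<^bsub>F\<^esub> cls [(v, b)] \<otimes>\<^bsub>F\<^esub> inv\<^bsub>F\<^esub> cls [(u, a)] \<otimes>\<^bsub>F\<^esub> inv\<^bsub>F\<^esub> cls [(v, b)] =
    cls ([(u, a), (v, b)] @ inv_word [(u, a)] @ inv_word [(v, b)])"
    if "adj u v" "a \<in> carrier (G u)" "b \<in> carrier (G v)" for u v a b
  proof -
    have w: "[(u, a)] \<in> words" "[(v, b)] \<in> words"
      using that adj_verts by auto
    then have "inv_word [(u, a)] \<in> words" "inv_word [(v, b)] \<in> words"
      by (blast intro: inv_word_words)+
    with w show ?thesis by (simp add: inv_cls mult_cls del: words_simps(2)) (simp add: mult_cls)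
  qed
  then show ?thesis unfolding gp_relators_def Let_def fp_incl_cls
    by (intro Collect_cong ex_cong1) (auto simp del: append.simps)
qed

lemma relators_act_trivially: "gp_relators \<Gamma> G \<subseteq> acts_trivially"
proof -
  have "cls ([(u, a), (v, b)] @ inv_word [(u, a)] @ inv_word [(v, b)]) \<in> acts_trivially"
    if h: "adj u v" "a \<in> carrier (G u)" "b \<in> carrier (G v)" for u v a b
  proof -
    have w: "[(u, a)] \<in> words" "[(v, b)] \<in> words"
      using that adj_verts by auto
    have "act [(u, a)] (act [(v, b)] (act (inv_word [(u, a)]) (act (inv_word [(v, b)]) w))) \<approx> w"
      if "reduced w" for w
    proof -
      let ?w = "act (inv_word [(u, a)]) (act (inv_word [(v, b)]) w)"
      have "act [(u, a)] (act [(v, b)] ?w) \<approx> act [(v, b)] (act [(u, a)] ?w)"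
        using lmul_commute[OF h(1)] by simp
      also have "act [(v, b)] (act [(u, a)] ?w) \<approx> act [(v, b)] (act (inv_word [(v, b)]) w)"
        by (intro shuffle_act act_inv_word) (use w that in \<open>simp_all add: reduced_act del: words_simps(2)\<close>)
      also (shuffle.trans) have "\<dots> \<approx> w" by (rule act_inv_word) (use w that in simp_all)
      finally (shuffle.trans) show ?thesis .
    qed
    moreover have "[(u, a), (v, b)] @ inv_word [(u, a)] @ inv_word [(v, b)] \<in> words"
      using w by simp
    ultimately show ?thesis by (simp add: cls_acts_trivially)
  qed
  then show ?thesis unfolding gp_relators_eq by blast
qed

lemma N_subset: "N \<subseteq> acts_trivially"
  using normal_acts_trivially relators_act_trivially unfolding normal_closure_def by blast

lemma relators_carrier: "gp_relators \<Gamma> G \<subseteq> carrier F"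
  using relators_act_trivially normal_acts_trivially
  by (auto simp: acts_trivially_def)

lemma N_normal: "N \<lhd> F"
  using normal_normal_closure[OF group_F] relators_carrier .

lemma relators_N: "gp_relators \<Gamma> G \<subseteq> N"
  unfolding normal_closure_def by blast

section \<open>Elements of the graph product represented by words\<close>

definition el :: "('v \<times> 'g) list \<Rightarrow> ('v \<times> 'g) list set set" where
  "el x = N #>\<^bsub>F\<^esub> cls x"

lemma P_eq: "P = F Mod N"
  by (simp add: graph_product_def Let_def)

lemma group_P: "group P"
  unfolding P_eq by (rule normal.factorgroup_is_group[OF N_normal])

lemma carrier_P: "carrier P = el ` words"
  unfolding P_eq el_def FactGroup_def RCOSETS_def carrier_F by auto

lemma el_carrier [simp]: "x \<in> words \<Longrightarrow> el x \<in> carrier P"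
  by (simp add: carrier_P)

lemma el_mult: "x \<in> words \<Longrightarrow> y \<in> words \<Longrightarrow> el x \<otimes>\<^bsub>P\<^esub> el y = el (x @ y)"
  unfolding P_eq el_def FactGroup_def
  by (simp add: normal.rcos_sum[OF N_normal] mult_cls)

lemma el_Nil: "el [] = \<one>\<^bsub>P\<^esub>"
proof -
  interpret normal N F by (rule N_normal)
  show ?thesis unfolding P_eq el_def FactGroup_def one_F[symmetric]
    using coset_join2 subset by (simp add: coset_mult_one)
qed

lemma el_eq_iff:
  assumes "x \<in> words" "y \<in> words"
  shows "el x = el y \<longleftrightarrow> cls (x @ inv_word y) \<in> N"
proof -
  interpret normal N F by (rule N_normal)
  have c: "cls x \<in> carrier F" "cls y \<in> carrier F" using assms by simp_all
  have "el x = el y \<longleftrightarrow> cls x \<otimes>\<^bsub>F\<^esub> inv\<^bsub>F\<^esub> cls y \<in> N"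
  proof
    assume "el x = el y"
    then have "cls x \<in> N #>\<^bsub>F\<^esub> cls y"
      unfolding el_def using rcos_self[OF c(1) is_subgroup] by simp
    then obtain n where "n \<in> N" "cls x = n \<otimes>\<^bsub>F\<^esub> cls y" by (auto simp: r_coset_def)
    then show "cls x \<otimes>\<^bsub>F\<^esub> inv\<^bsub>F\<^esub> cls y \<in> N" using c subset by (simp add: m_assoc subsetD)
  next
    assume n: "cls x \<otimes>\<^bsub>F\<^esub> inv\<^bsub>F\<^esub> cls y \<in> N"
    have "cls x = (cls x \<otimes>\<^bsub>F\<^esub> inv\<^bsub>F\<^esub> cls y) \<otimes>\<^bsub>F\<^esub> cls y" using c by (simp add: m_assoc)
    then have "cls x \<in> N #>\<^bsub>F\<^esub> cls y" using n unfolding r_coset_def by blast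
    then show "el x = el y"
      unfolding el_def using repr_independence c(2) is_subgroup by metis
  qed
  then show ?thesis using assms by (simp add: inv_cls mult_cls)
qed

lemma el_rel: "(x, y) \<in> rel \<Longrightarrow> el x = el y"
  unfolding el_def using cls_eq_iff rel_words by metis

lemma el_inv: "x \<in> words \<Longrightarrow> inv\<^bsub>P\<^esub> (el x) = el (inv_word x)"
  by (rule group.inv_equality[OF group_P])
    (simp_all add: el_mult el_rel[OF inv_word_left] el_Nil)

text \<open>Since \<open>N\<close> acts trivially, the action depends only on the element
  represented. Applied to \<open>[]\<close>, this gives uniqueness of normal forms up to
  shuffling.\<close>

lemma el_act_cong:
  assumes "x \<in> words" "y \<in> words" "el x = el y" "reduced w"
  shows "act x w \<approx> act y w"
proof -
  have "cls (x @ inv_word y) \<in> acts_trivially" using assms el_eq_iff N_subset by blast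
  then have "act x (act (inv_word y) (act y w)) \<approx> act y w"
    using assms by (auto simp: cls_acts_trivially reduced_act)
  moreover have "act x (act (inv_word y) (act y w)) \<approx> act x w"
    using assms by (intro shuffle_act act_inv_word)
  ultimately show ?thesis by (meson shuffle.trans shuffle_sym)
qed

lemma el_one: "u \<in> pverts \<Gamma> \<Longrightarrow> el [(u, \<one>\<^bsub>G u\<^esub>)] = \<one>\<^bsub>P\<^esub>"
  using el_rel[OF fp_one[of "[]" _ _ "[]" u]] by (simp add: el_Nil)

lemma el_letter_mult:
  "u \<in> pverts \<Gamma> \<Longrightarrow> a \<in> carrier (G u) \<Longrightarrow> b \<in> carrier (G u) \<Longrightarrow>
    el [(u, a)] \<otimes>\<^bsub>P\<^esub> el [(u, b)] = el [(u, a \<otimes>\<^bsub>G u\<^esub> b)]"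
  using el_rel[OF fp_mult[of "[]" _ _ "[]" u a b]] by (simp add: el_mult)

lemma el_commute:
  assumes "adj u v" "a \<in> carrier (G u)" "b \<in> carrier (G v)"
  shows "el [(u, a)] \<otimes>\<^bsub>P\<^esub> el [(v, b)] = el [(v, b)] \<otimes>\<^bsub>P\<^esub> el [(u, a)]"
proof -
  have w: "[(u, a)] \<in> words" "[(v, b)] \<in> words"
    using assms adj_verts by auto
  have "cls ([(u, a), (v, b)] @ inv_word [(u, a)] @ inv_word [(v, b)]) \<in> N"
    using relators_N assms unfolding gp_relators_eq by blast
  then have "cls ([(u, a), (v, b)] @ inv_word [(v, b), (u, a)]) \<in> N"
    by (simp add: inv_word_def)
  then have "el [(u, a), (v, b)] = el [(v, b), (u, a)]"
    using w by (subst el_eq_iff) auto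
  then show ?thesis using w by (simp add: el_mult del: words_simps(2))
qed

end

section \<open>Heads and walls\<close>

text \<open>Collects what the geometry uses of normal forms: \<open>H u\<close> are the vertex
  groups, \<open>\<sigma> u x\<close> is the head syllable and \<open>len\<close> the number of
  syllables. Stated for group elements, it keeps words and shuffling out of the geometric
  arguments.\<close>

locale head_group = group P for P :: "('p, 'q) monoid_scheme" (structure) +
  fixes V :: "'v set" and E :: "'v \<Rightarrow> 'v \<Rightarrow> bool" and H :: "'v \<Rightarrow> 'p set"
    and \<sigma> :: "'v \<Rightarrow> 'p \<Rightarrow> 'p" and len :: "'p \<Rightarrow> nat"
  assumes finite_V: "finite V"
    and E_sym: "E u v \<Longrightarrow> E v u"
    and E_irrefl: "\<not> E u u"
    and H_subgroup: "u \<in> V \<Longrightarrow> subgroup (H u) P"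
    and H_commute: "u \<in> V \<Longrightarrow> v \<in> V \<Longrightarrow> E u v \<Longrightarrow> a \<in> H u \<Longrightarrow> b \<in> H v \<Longrightarrow> a \<otimes> b = b \<otimes> a"
    and head_closed: "u \<in> V \<Longrightarrow> x \<in> carrier P \<Longrightarrow> \<sigma> u x \<in> H u"
    and head_one: "u \<in> V \<Longrightarrow> \<sigma> u \<one> = \<one>"
    and head_mult: "u \<in> V \<Longrightarrow> a \<in> H u \<Longrightarrow> x \<in> carrier P \<Longrightarrow> \<sigma> u (a \<otimes> x) = a \<otimes> \<sigma> u x"
    and head_mult_adj: "u \<in> V \<Longrightarrow> v \<in> V \<Longrightarrow> E u v \<Longrightarrow> b \<in> H v \<Longrightarrow> x \<in> carrier P \<Longrightarrow>
      \<sigma> u (b \<otimes> x) = \<sigma> u x"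
    and heads_adj: "u \<in> V \<Longrightarrow> v \<in> V \<Longrightarrow> u \<noteq> v \<Longrightarrow> x \<in> carrier P \<Longrightarrow> \<sigma> u x \<noteq> \<one> \<Longrightarrow> \<sigma> v x \<noteq> \<one> \<Longrightarrow> E u v"
    and head_exists: "x \<in> carrier P \<Longrightarrow> x \<noteq> \<one> \<Longrightarrow> \<exists>u\<in>V. \<sigma> u x \<noteq> \<one>"
    and len_head: "u \<in> V \<Longrightarrow> x \<in> carrier P \<Longrightarrow> \<sigma> u x \<noteq> \<one> \<Longrightarrow> len (inv (\<sigma> u x) \<otimes> x) < len x"
    and len_inv: "x \<in> carrier P \<Longrightarrow> len (inv x) = len x"
begin

lemma H_carrier [simp]: "a \<in> H u \<Longrightarrow> u \<in> V \<Longrightarrow> a \<in> carrier P"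
  by (meson H_subgroup subgroup.mem_carrier)

lemma H_inv: "u \<in> V \<Longrightarrow> a \<in> H u \<Longrightarrow> inv a \<in> H u"
  by (meson H_subgroup subgroup.m_inv_closed)

lemma H_one: "u \<in> V \<Longrightarrow> \<one> \<in> H u"
  by (meson H_subgroup subgroup.one_closed)

lemma H_mult: "u \<in> V \<Longrightarrow> a \<in> H u \<Longrightarrow> b \<in> H u \<Longrightarrow> a \<otimes> b \<in> H u"
  by (meson H_subgroup subgroup.m_closed)

lemma head_carrier [simp]: "u \<in> V \<Longrightarrow> x \<in> carrier P \<Longrightarrow> \<sigma> u x \<in> carrier P"
  by (rule H_carrier[OF head_closed])

lemma head_self: "u \<in> V \<Longrightarrow> a \<in> H u \<Longrightarrow> \<sigma> u a = a"
  using head_mult[of u a \<one>] by (simp add: head_one)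

lemma cancel_inv [simp]:
  "a \<in> carrier P \<Longrightarrow> x \<in> carrier P \<Longrightarrow> inv a \<otimes> (a \<otimes> x) = x"
  "a \<in> carrier P \<Longrightarrow> x \<in> carrier P \<Longrightarrow> a \<otimes> (inv a \<otimes> x) = x"
  by (simp_all add: m_assoc[symmetric])

lemma inv_eq_one: "x \<in> carrier P \<Longrightarrow> inv x = \<one> \<longleftrightarrow> x = \<one>"
  by (metis inv_inv inv_one)

lemma head_split:
  assumes "u \<in> V" "x \<in> carrier P" "\<sigma> u x \<noteq> \<one>"
  obtains x' where "x' \<in> carrier P" "x = \<sigma> u x \<otimes> x'" "\<sigma> u x' = \<one>" "len x' < len x"
proof
  let ?x = "inv (\<sigma> u x) \<otimes> x"
  show "?x \<in> carrier P" "x = \<sigma> u x \<otimes> ?x" "len ?x < len x"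
    using assms by (simp_all add: len_head)
  show "\<sigma> u ?x = \<one>" using assms by (simp add: head_mult H_inv head_closed)
qed

text \<open>Removing a head decreases \<open>len\<close>. The premise
  \<open>\<sigma> u x = \<one>\<close> says that the prepended syllable does not merge, so this is
  induction along a normal form.\<close>

lemma head_induct [consumes 1, case_names one mult]:
  assumes "x \<in> carrier P" and one: "Q \<one>"
    and mult: "\<And>u c x. u \<in> V \<Longrightarrow> c \<in> H u \<Longrightarrow> c \<noteq> \<one> \<Longrightarrow> x \<in> carrier P \<Longrightarrow> \<sigma> u x = \<one> \<Longrightarrow> Q x \<Longrightarrow> Q (c \<otimes> x)"
  shows "Q x"
  using assms(1)
proof (induction "len x" arbitrary: x rule: less_induct)
  case less
  show ?case
  proof (cases "x = \<one>")
    case False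
    then obtain u where u: "u \<in> V" "\<sigma> u x \<noteq> \<one>" using head_exists less.prems by blast
    obtain x' where x': "x' \<in> carrier P" "x = \<sigma> u x \<otimes> x'" "\<sigma> u x' = \<one>" "len x' < len x"
      by (rule head_split[OF u(1) less.prems u(2)])
    have "Q (\<sigma> u x \<otimes> x')"
      by (rule mult[OF u(1) head_closed[OF u(1) less.prems] u(2) x'(1,3)])
        (rule less.hyps[OF x'(4,1)])
    then show ?thesis using x'(2) by simp
  qed (simp add: one)
qed

section \<open>Subgroups generated by vertex groups\<close>

definition gen :: "'v set \<Rightarrow> 'p set" where
  "gen A = generate P (\<Union>u\<in>A. H u)"

lemma gen_subgroup: "A \<subseteq> V \<Longrightarrow> subgroup (gen A) P"
  unfolding gen_def by (rule generate_is_subgroup) auto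

lemma gen_carrier: "A \<subseteq> V \<Longrightarrow> x \<in> gen A \<Longrightarrow> x \<in> carrier P"
  using gen_subgroup subgroup.mem_carrier by metis

lemma gen_incl: "u \<in> A \<Longrightarrow> a \<in> H u \<Longrightarrow> a \<in> gen A"
  unfolding gen_def by (rule generate.incl) blast

lemma gen_mult: "x \<in> gen A \<Longrightarrow> y \<in> gen A \<Longrightarrow> x \<otimes> y \<in> gen A"
  unfolding gen_def by (rule generate.eng)

lemma gen_inv: "A \<subseteq> V \<Longrightarrow> x \<in> gen A \<Longrightarrow> inv x \<in> gen A"
  using gen_subgroup subgroup.m_inv_closed by metis

lemma gen_one: "\<one> \<in> gen A"
  unfolding gen_def by (rule generate.one)

lemma gen_mono: "A \<subseteq> B \<Longrightarrow> gen A \<subseteq> gen B"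
  unfolding gen_def by (rule mono_generate) auto

lemma gen_empty: "gen {} = {\<one>}"
  unfolding gen_def using generate_empty by simp

lemma gen_induct [consumes 2, case_names one mult]:
  assumes "x \<in> gen A" "A \<subseteq> V" and one: "Q \<one>"
    and mult: "\<And>u c x. u \<in> A \<Longrightarrow> c \<in> H u \<Longrightarrow> x \<in> gen A \<Longrightarrow> Q x \<Longrightarrow> Q (c \<otimes> x)"
  shows "Q x"
proof -
  \<comment> \<open>Strengthened to: left multiplication by \<open>x\<close> preserves
    \<open>Q\<close> on \<open>gen A\<close>. Unlike \<open>Q x\<close>, this passes to
    products.\<close>
  have "x \<in> gen A \<and> (\<forall>y\<in>gen A. Q y \<longrightarrow> Q (x \<otimes> y))"
    using assms(1)[unfolded gen_def]
  proof (induction rule: generate.induct)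
    case one
    then show ?case using assms(2) by (auto simp: gen_one gen_carrier)
  next
    case (incl h)
    then show ?case using mult gen_incl by blast
  next
    case (inv h)
    then obtain u where u: "u \<in> A" "inv h \<in> H u" using H_inv assms(2) by blast
    then show ?case using mult gen_incl by blast
  next
    case (eng h1 h2)
    then show ?case using assms(2) by (auto simp: m_assoc gen_carrier gen_mult)
  qed
  then have "Q (x \<otimes> \<one>)" using one gen_one by blast
  then show ?thesis using assms gen_carrier by simp
qed

abbreviation link :: "'v \<Rightarrow> 'v set" where
  "link u \<equiv> {w \<in> V. E u w}"

lemma link_head:
  assumes "u \<in> V" "z \<in> gen (link u)" "y \<in> carrier P"
  shows "\<sigma> u (z \<otimes> y) = \<sigma> u y"
proof -
  have "link u \<subseteq> V" by auto
  from assms(2) this show ?thesis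
  proof (induction rule: gen_induct)
    case one
    then show ?case using assms by simp
  next
    case (mult w c x)
    then have x: "x \<in> carrier P" "c \<in> carrier P" using gen_carrier[of "link u"] by auto
    then have "\<sigma> u (c \<otimes> (x \<otimes> y)) = \<sigma> u (x \<otimes> y)"
      using mult assms by (intro head_mult_adj) auto
    then show ?case using mult.IH x assms by (simp add: m_assoc)
  qed
qed

lemma link_commute:
  assumes "u \<in> V" "z \<in> gen (link u)" "a \<in> H u"
  shows "z \<otimes> a = a \<otimes> z"
proof -
  have "link u \<subseteq> V" by auto
  from assms(2) this show ?thesis
  proof (induction rule: gen_induct)
    case one
    then show ?case using assms by simp
  next
    case (mult w c x)
    then have x: "x \<in> carrier P" "c \<in> carrier P" "a \<in> carrier P"
      using gen_carrier[of "link u"] assms by auto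
    have "a \<otimes> c = c \<otimes> a"
      using H_commute[of u w a c] mult assms by auto
    then have "c \<otimes> (a \<otimes> x) = a \<otimes> (c \<otimes> x)" using x by (simp add: m_assoc[symmetric])
    then show ?case using mult.IH x by (simp add: m_assoc)
  qed
qed

text \<open>A letter appended at the right can change only the head of its own vertex, and it
  reaches that head only if all that follows the head lies in the link. The claims are proved
  together since the blocked case of the induction uses both.\<close>

lemma head_mult_right_aux:
  assumes "x \<in> carrier P" "u \<in> V" "v \<in> V" "b \<in> H v"
  shows "(v \<noteq> u \<longrightarrow> \<sigma> u (x \<otimes> b) = \<sigma> u x) \<and>
    (v = u \<longrightarrow> \<sigma> u (x \<otimes> b) \<noteq> \<sigma> u x \<longrightarrow> inv (\<sigma> u x) \<otimes> x \<in> gen (link u))"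
  using assms
proof (induction arbitrary: u v b rule: head_induct)
  case one
  then show ?case
    using heads_adj[of u v b] head_mult_adj[of u v b \<one>]
    by (cases "b = \<one>") (auto simp: head_one head_self gen_one)
next
  case (mult w c x)
  note [simp] = mult.hyps(1,2,4) mult.prems
  have [simp]: "c \<in> carrier P" "b \<in> carrier P"
    by (rule H_carrier[OF mult.hyps(2,1)], rule H_carrier[OF mult.prems(3,2)])
  have assoc: "c \<otimes> x \<otimes> b = c \<otimes> (x \<otimes> b)" by (simp add: m_assoc)
  have cx: "\<sigma> w (c \<otimes> x) = c" by (simp add: head_mult mult.hyps)
  have IH1: "\<sigma> u (x \<otimes> b) = \<sigma> u x" if "u \<in> V" "v \<in> V" "v \<noteq> u" "b \<in> H v" for u v b
    using mult.IH that by blast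
  have IH2: "inv (\<sigma> u x) \<otimes> x \<in> gen (link u)"
    if "u \<in> V" "b \<in> H u" "\<sigma> u (x \<otimes> b) \<noteq> \<sigma> u x" for u b
    using mult.IH that by blast
  consider "u = w" | "E u w" | "u \<noteq> w" "\<not> E u w" by blast
  then show ?case
  proof cases
    case 1
    have "v = w \<Longrightarrow> b \<in> H w" using mult.prems(3) by blast
    then show ?thesis
      unfolding assoc using 1 IH1[of u v b] IH2[of u b] mult.hyps by (auto simp: head_mult)
  next
    case 2
    have "inv (\<sigma> u x) \<otimes> (c \<otimes> x) = c \<otimes> (inv (\<sigma> u x) \<otimes> x)"
      using H_commute[of u w "inv (\<sigma> u x)" c] 2 H_inv head_closed
      by (simp add: m_assoc[symmetric])
    moreover have "c \<in> gen (link u)" using 2 by (intro gen_incl[of w]) auto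
    moreover have "v = u \<Longrightarrow> b \<in> H u" using mult.prems(3) by blast
    moreover have "\<sigma> u (c \<otimes> y) = \<sigma> u y" if "y \<in> carrier P" for y
      using 2 that by (intro head_mult_adj[of u w]) auto
    ultimately show ?thesis
      unfolding assoc using IH1[of u v b] IH2[of u b] 2 by (auto intro: gen_mult)
  next
    \<comment> \<open>The first letter \<open>c\<close> blocks \<open>u\<close>, so both heads are
      trivial unless \<open>b\<close> cancels \<open>c\<close>. In that event \<open>x\<close> lies
      in the link of \<open>w\<close>, and the product collapses to \<open>x\<close>, whose head at
      \<open>u\<close> equals that of \<open>x \<otimes> c = c \<otimes> x\<close>.\<close>
    case 3
    have 0: "\<sigma> u y = \<one>" if "y \<in> carrier P" "\<sigma> w y \<noteq> \<one>" for y
      using heads_adj[of u w y] 3 that by auto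
    have 1: "\<sigma> u (c \<otimes> x) = \<one>" by (rule 0) (simp_all add: cx mult.hyps)
    have "\<sigma> u (c \<otimes> (x \<otimes> b)) = \<one>"
    proof (rule ccontr)
      assume ne: "\<sigma> u (c \<otimes> (x \<otimes> b)) \<noteq> \<one>"
      then have "\<sigma> w (c \<otimes> (x \<otimes> b)) = \<one>" using 0[of "c \<otimes> (x \<otimes> b)"] by auto
      then have c: "c \<otimes> \<sigma> w (x \<otimes> b) = \<one>" by (simp add: head_mult)
      then have "\<sigma> w (x \<otimes> b) \<noteq> \<one>" using mult.hyps by auto
      then have vw: "v = w" using IH1[of w v b] mult.hyps by auto
      have bw: "b \<in> H w" using mult.prems(3) unfolding vw .
      then have x: "x \<in> gen (link w)"
        using IH2[of w b] \<open>\<sigma> w (x \<otimes> b) \<noteq> \<one>\<close> mult.hyps by auto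
      then have "\<sigma> w (x \<otimes> b) = b" using link_head[of w x b] head_self[of w b] bw by auto
      then have "c \<otimes> b = \<one>" using c by simp
      then have "c \<otimes> (x \<otimes> b) = x"
        using link_commute[of w x b] x bw by (simp add: m_assoc[symmetric])
      moreover have "\<sigma> u x = \<sigma> u (x \<otimes> c)" using IH1[of u w c] 3 by auto
      moreover have "x \<otimes> c = c \<otimes> x" using link_commute[of w x c] x by auto
      ultimately show False using ne 1 by simp
    qed
    then show ?thesis using 1 unfolding assoc by simp
  qed
qed

lemma head_mult_right:
  "x \<in> carrier P \<Longrightarrow> u \<in> V \<Longrightarrow> v \<in> V \<Longrightarrow> v \<noteq> u \<Longrightarrow> b \<in> H v \<Longrightarrow> \<sigma> u (x \<otimes> b) = \<sigma> u x"
  using head_mult_right_aux by blast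

lemma head_mult_right_ne:
  assumes "x \<in> carrier P" "u \<in> V" "b \<in> H u" "\<sigma> u (x \<otimes> b) \<noteq> \<sigma> u x"
  obtains z where "z \<in> gen (link u)" "z \<in> carrier P" "x = \<sigma> u x \<otimes> z"
proof
  let ?z = "inv (\<sigma> u x) \<otimes> x"
  show "?z \<in> gen (link u)" using head_mult_right_aux assms by blast
  show "?z \<in> carrier P" "x = \<sigma> u x \<otimes> ?z" using assms by simp_all
qed

section \<open>Labels of separating walls\<close>

definition sep :: "'p \<Rightarrow> 'p \<Rightarrow> 'v set" where
  "sep x y = {u \<in> V. \<exists>k\<in>carrier P. \<sigma> u (k \<otimes> x) \<noteq> \<sigma> u (k \<otimes> y)}"

lemma sep_subset: "sep x y \<subseteq> V"
  by (auto simp: sep_def)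

lemma sep_sym: "sep x y = sep y x"
  unfolding sep_def by metis

lemma sep_self: "sep x x = {}"
  by (auto simp: sep_def)

lemma sep_triangle: "sep x z \<subseteq> sep x y \<union> sep y z"
  unfolding sep_def by auto

text \<open>Left translation permutes the walls and keeps their labels: it replaces \<open>k\<close>
  by \<open>k \<otimes> g\<close>.\<close>

lemma sep_mult_left_le:
  assumes "g \<in> carrier P" "x \<in> carrier P" "y \<in> carrier P"
  shows "sep (g \<otimes> x) (g \<otimes> y) \<subseteq> sep x y"
proof
  fix u assume "u \<in> sep (g \<otimes> x) (g \<otimes> y)"
  then obtain k where k: "u \<in> V" "k \<in> carrier P" "\<sigma> u (k \<otimes> g \<otimes> x) \<noteq> \<sigma> u (k \<otimes> g \<otimes> y)"
    using assms by (auto simp: sep_def m_assoc)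
  moreover have "k \<otimes> g \<in> carrier P" using k assms by simp
  ultimately show "u \<in> sep x y" unfolding sep_def by blast
qed

lemma sep_mult_left:
  assumes "g \<in> carrier P" "x \<in> carrier P" "y \<in> carrier P"
  shows "sep (g \<otimes> x) (g \<otimes> y) = sep x y"
  using sep_mult_left_le[of g x y] sep_mult_left_le[of "inv g" "g \<otimes> x" "g \<otimes> y"] assms by auto

lemma sep_H: "v \<in> V \<Longrightarrow> a \<in> H v \<Longrightarrow> x \<in> carrier P \<Longrightarrow> sep x (x \<otimes> a) \<subseteq> {v}"
  unfolding sep_def using head_mult_right[of _ _ v a]
  by (auto simp: m_assoc[symmetric]) (metis m_closed)

lemma sep_gen:
  assumes "z \<in> gen A" "A \<subseteq> V" shows "sep \<one> z \<subseteq> A"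
  using assms
proof (induction rule: gen_induct)
  case one
  then show ?case by (simp add: sep_self)
next
  case (mult v c x)
  then have v: "v \<in> V" "x \<in> carrier P" "c \<in> carrier P" using gen_carrier assms(2) by auto
  then have "sep \<one> c \<subseteq> {v}" "sep c (c \<otimes> x) = sep \<one> x"
    using mult sep_H[of v c \<one>] sep_mult_left[of c \<one> x] by auto
  then show ?case using mult.IH mult.hyps(1) sep_triangle[of \<one> "c \<otimes> x" c] by blast
qed

text \<open>The wall with \<open>k = \<one>\<close> at the first syllable separates
  \<open>\<one>\<close> from \<open>z\<close>, so its label lies in \<open>A\<close>. Removing this
  syllable adds no other label, and the induction continues.\<close>

lemma gen_sep:
  assumes "z \<in> carrier P" "A \<subseteq> V" "sep \<one> z \<subseteq> A"
  shows "z \<in> gen A"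
  using assms
proof (induction rule: head_induct)
  case one
  then show ?case by (simp add: gen_one)
next
  case (mult u c x)
  have c: "c \<in> carrier P" using mult by auto
  then have "\<sigma> u (\<one> \<otimes> \<one>) \<noteq> \<sigma> u (\<one> \<otimes> (c \<otimes> x))"
    using mult.hyps by (auto simp: head_mult head_one)
  then have "u \<in> A" using mult.hyps mult.prems(2) unfolding sep_def by blast
  moreover have "sep c \<one> \<subseteq> {u}" "sep c (c \<otimes> x) = sep \<one> x"
    using mult.hyps c sep_H[of u c \<one>] sep_mult_left[of c \<one> x] by (auto simp: sep_sym[of c])
  then have "sep \<one> x \<subseteq> A"
    using mult.prems sep_triangle[of c "c \<otimes> x" \<one>] \<open>u \<in> A\<close> by blast
  ultimately show ?case using mult by (blast intro: gen_mult gen_incl)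
qed

lemma sep_iff_gen:
  assumes "x \<in> carrier P" "y \<in> carrier P" "A \<subseteq> V"
  shows "sep x y \<subseteq> A \<longleftrightarrow> inv x \<otimes> y \<in> gen A"
proof -
  have "sep x y = sep \<one> (inv x \<otimes> y)"
    using assms sep_mult_left[of x \<one> "inv x \<otimes> y"] by simp
  moreover have "inv x \<otimes> y \<in> carrier P" using assms by simp
  ultimately show ?thesis using gen_sep[of "inv x \<otimes> y" A] sep_gen[of "inv x \<otimes> y" A] assms(3) by metis
qed

lemma sep_empty: "x \<in> carrier P \<Longrightarrow> y \<in> carrier P \<Longrightarrow> sep x y = {} \<Longrightarrow> x = y"
  using sep_iff_gen[of x y "{}"] by (simp add: gen_empty) (metis inv_closed inv_equality inv_inv)

text \<open>As \<open>x\<close> and \<open>q\<close> have no head vertex in common, nothing merges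
  where \<open>inv x\<close> meets \<open>q\<close>, so the heads of \<open>inv x\<close> survive.
  The letters of \<open>q\<close> are moved over to \<open>inv x\<close> one at a time.\<close>

lemma reduced_product_head:
  assumes "q \<in> carrier P" "x \<in> carrier P" "\<forall>t\<in>V. \<sigma> t x = \<one> \<or> \<sigma> t q = \<one>"
    "w \<in> V" "\<sigma> w (inv x) \<noteq> \<one>"
  shows "\<sigma> w (inv x \<otimes> q) = \<sigma> w (inv x)"
  using assms
proof (induction arbitrary: x rule: head_induct)
  case one
  then show ?case by simp
next
  case (mult v c q)
  note [simp] = mult.hyps(1,2,4) mult.prems(1,3)
  have [simp]: "c \<in> carrier P" by (rule H_carrier[OF mult.hyps(2,1)])
  have "\<sigma> v (c \<otimes> q) \<noteq> \<one>" using mult.hyps(3,5) by (simp add: head_mult)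
  then have vx: "\<sigma> v x = \<one>" using mult.prems(2) by auto
  let ?x = "inv c \<otimes> x"
  have inv: "inv ?x = inv x \<otimes> c" by (simp add: inv_mult_group)
  \<comment> \<open>Appending \<open>c\<close> changes a head only at \<open>v\<close>, and only if
    the rest of \<open>inv x\<close> lies in the link. But then \<open>x\<close> has a nontrivial
    head at \<open>v\<close>, which \<open>vx\<close> excludes.\<close>
  have w: "\<sigma> w (inv ?x) = \<sigma> w (inv x)"
  proof (rule ccontr)
    assume ne: "\<sigma> w (inv ?x) \<noteq> \<sigma> w (inv x)"
    then have "w = v" using head_mult_right[of "inv x" w v c] inv by auto
    then have "\<sigma> v (inv x \<otimes> c) \<noteq> \<sigma> v (inv x)" using ne inv by simp
    then obtain z where z: "z \<in> gen (link v)" "z \<in> carrier P" "inv x = \<sigma> v (inv x) \<otimes> z"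
      using head_mult_right_ne[of "inv x" v c] by auto
    let ?s = "\<sigma> v (inv x)"
    have s: "inv ?s \<in> H v" by (simp add: H_inv head_closed)
    have "x = inv (?s \<otimes> z)" using z(3) by (metis inv_inv mult.prems(1))
    moreover have "?s \<in> carrier P" by simp
    ultimately have "x = inv z \<otimes> inv ?s" using inv_mult_group[of ?s z] z(2) by argo
    moreover have "inv z \<in> gen (link v)" using z gen_inv[of "link v"] by auto
    ultimately have "\<sigma> v x = inv ?s" using link_head[of v "inv z" "inv ?s"] s head_self[of v "inv ?s"]
      by simp
    moreover have "inv ?s \<noteq> \<one>" using mult.prems(4) \<open>w = v\<close> by (simp add: inv_eq_one)
    ultimately show False using vx by simp
  qed
  have "\<forall>t\<in>V. \<sigma> t ?x = \<one> \<or> \<sigma> t q = \<one>"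
  proof
    fix t assume t: "t \<in> V"
    show "\<sigma> t ?x = \<one> \<or> \<sigma> t q = \<one>"
    proof (cases "\<sigma> t ?x = \<one> \<or> t = v")
      case False
      have "\<sigma> v ?x \<noteq> \<one>" using vx mult.hyps by (simp add: head_mult H_inv inv_eq_one)
      then have "E t v" using False heads_adj[of t v ?x] t by auto
      then have "\<sigma> t ?x = \<sigma> t x" "\<sigma> t (c \<otimes> q) = \<sigma> t q" using t head_mult_adj[of t v] H_inv[of v c] by simp_all
      then show ?thesis using mult.prems(2) t by auto
    qed (use mult.hyps in auto)
  qed
  then have "\<sigma> w (inv ?x \<otimes> q) = \<sigma> w (inv ?x)"
    using mult.IH[of ?x] mult.prems(4) w by simp
  moreover have "inv ?x \<otimes> q = inv x \<otimes> (c \<otimes> q)" unfolding inv by (simp add: m_assoc)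
  ultimately show ?case using w by simp
qed

section \<open>Nested and transverse walls\<close>

lemma star_translate:
  assumes "u \<in> V" "w \<in> V" "w = u \<or> E u w" "s \<in> H w"
  obtains c where "c \<in> H u" "\<And>z. z \<in> carrier P \<Longrightarrow> \<sigma> u (s \<otimes> z) = c \<otimes> \<sigma> u z"
  using assms head_mult[of u s] head_mult_adj[of u w s] H_one[of u] that by fastforce

text \<open>
  For a wall \<open>z \<mapsto> \<sigma> u (k \<otimes> z)\<close> whose \<open>k\<close> has been shortened as much as possible, the points
  of the nontrivial sectors all inherit the heads of \<open>inv k\<close>.
\<close>

lemma minimal_wall_heads:
  assumes "u \<in> V" "k \<in> carrier P" "z \<in> carrier P"
    and min: "\<And>w. w \<in> V \<Longrightarrow> w = u \<or> E u w \<Longrightarrow> \<sigma> w k = \<one>"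
    and "\<sigma> u (k \<otimes> z) \<noteq> \<one>" "w \<in> V" "\<sigma> w (inv k) \<noteq> \<one>"
  shows "\<sigma> w z = \<sigma> w (inv k)"
proof -
  have "\<sigma> t k = \<one> \<or> \<sigma> t (k \<otimes> z) = \<one>" if "t \<in> V" for t
    using heads_adj[of u t "k \<otimes> z"] min[of t] that assms by auto
  then show ?thesis
    using reduced_product_head[of "k \<otimes> z" k w] assms by simp
qed

text \<open>Letters of the star of \<open>u\<close> at the left end of \<open>k\<close>, or of the
  star of \<open>v\<close> at its right end, only translate the heads and are stripped off. If
  \<open>k \<noteq> \<one>\<close> remains, each point in a nontrivial sector of the first wall has
  a head at a vertex distinct from \<open>v\<close> and not adjacent to it, so its head at
  \<open>v\<close> is trivial. For \<open>u = v\<close> the walls may also coincide up to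
  translation.\<close>

lemma walls_transverse_or_nested:
  assumes "u \<in> V" "v \<in> V" "\<not> E u v" "k \<in> carrier P"
  shows "(u = v \<and> (\<exists>c\<in>H u. \<forall>z\<in>carrier P. \<sigma> u (k \<otimes> z) = c \<otimes> \<sigma> v z)) \<or>
    (\<exists>\<alpha> \<beta>. \<forall>z\<in>carrier P. \<sigma> u (k \<otimes> z) = \<alpha> \<or> \<sigma> v z = \<beta>)"
  using assms(4)
proof (induction "len k" arbitrary: k rule: less_induct)
  case less
  note [simp] = assms(1,2) less.prems
  consider (left) w where "w \<in> V" "w = u \<or> E u w" "\<sigma> w k \<noteq> \<one>"
    | (right) w where "w \<in> V" "w = v \<or> E v w" "\<sigma> w (inv k) \<noteq> \<one>"
    | (min) "\<And>w. w \<in> V \<Longrightarrow> w = u \<or> E u w \<Longrightarrow> \<sigma> w k = \<one>"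
      "\<And>w. w \<in> V \<Longrightarrow> w = v \<or> E v w \<Longrightarrow> \<sigma> w (inv k) = \<one>" by blast
  then show ?case
  proof cases
    case left
    obtain k' where k': "k' \<in> carrier P" "k = \<sigma> w k \<otimes> k'" "len k' < len k"
      by (rule head_split[OF left(1) less.prems left(3)])
    obtain c where c: "c \<in> H u" "\<And>z. z \<in> carrier P \<Longrightarrow> \<sigma> u (\<sigma> w k \<otimes> z) = c \<otimes> \<sigma> u z"
      using star_translate[of u w "\<sigma> w k"] left head_closed by auto
    have "k \<otimes> z = \<sigma> w k \<otimes> (k' \<otimes> z)" if "z \<in> carrier P" for z
      using k' left that by (metis head_carrier less.prems m_assoc)
    then have *: "\<sigma> u (k \<otimes> z) = c \<otimes> \<sigma> u (k' \<otimes> z)" if "z \<in> carrier P" for z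
      using c(2)[of "k' \<otimes> z"] that k' by simp
    from less.hyps[OF k'(3) k'(1)] show ?thesis
    proof (elim disjE conjE exE bexE)
      fix d assume d: "u = v" "d \<in> H u" "\<forall>z\<in>carrier P. \<sigma> u (k' \<otimes> z) = d \<otimes> \<sigma> v z"
      then have "c \<otimes> d \<in> H u" "\<forall>z\<in>carrier P. \<sigma> u (k \<otimes> z) = (c \<otimes> d) \<otimes> \<sigma> v z"
        using * c d by (auto simp: m_assoc H_mult)
      then show ?thesis using d(1) by blast
    next
      fix \<alpha> \<beta> assume "\<forall>z\<in>carrier P. \<sigma> u (k' \<otimes> z) = \<alpha> \<or> \<sigma> v z = \<beta>"
      then have "\<forall>z\<in>carrier P. \<sigma> u (k \<otimes> z) = c \<otimes> \<alpha> \<or> \<sigma> v z = \<beta>" using * by auto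
      then show ?thesis by blast
    qed
  next
    case right
    let ?s = "\<sigma> w (inv k)"
    obtain r where r: "r \<in> carrier P" "inv k = ?s \<otimes> r" "len r < len (inv k)"
      using head_split[of w "inv k"] right by auto
    have s: "?s \<in> carrier P" "inv ?s \<in> H w" using right by (simp_all add: H_inv head_closed)
    have "k = inv (?s \<otimes> r)" using r(2) by (metis inv_inv less.prems)
    then have k: "k = inv r \<otimes> inv ?s" unfolding inv_mult_group[OF s(1) r(1)] .
    have l: "len (inv r) < len k" using r by (simp add: len_inv)
    obtain c where c: "c \<in> H v" "\<And>z. z \<in> carrier P \<Longrightarrow> \<sigma> v (inv ?s \<otimes> z) = c \<otimes> \<sigma> v z"
      using star_translate[of v w "inv ?s"] right s by auto
    have kz: "k \<otimes> z = inv r \<otimes> (inv ?s \<otimes> z)" if "z \<in> carrier P" for z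
      using k that s r by (metis inv_closed m_assoc)
    from less.hyps[OF l inv_closed[OF r(1)]] show ?thesis
    proof (elim disjE conjE exE bexE)
      fix d assume d: "u = v" "d \<in> H u" "\<forall>z\<in>carrier P. \<sigma> u (inv r \<otimes> z) = d \<otimes> \<sigma> v z"
      then have "d \<otimes> c \<in> H u" "\<forall>z\<in>carrier P. \<sigma> u (k \<otimes> z) = (d \<otimes> c) \<otimes> \<sigma> v z"
        using kz c s by (auto simp: m_assoc H_mult)
      then show ?thesis using d(1) by blast
    next
      fix \<alpha> \<beta> assume *: "\<forall>z\<in>carrier P. \<sigma> u (inv r \<otimes> z) = \<alpha> \<or> \<sigma> v z = \<beta>"
      have "\<sigma> u (k \<otimes> z) = \<alpha> \<or> \<sigma> v z = inv c \<otimes> \<beta>" if z: "z \<in> carrier P" for z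
      proof -
        have "\<sigma> u (inv r \<otimes> (inv ?s \<otimes> z)) = \<alpha> \<or> \<sigma> v (inv ?s \<otimes> z) = \<beta>" using * z s by simp
        then show ?thesis using kz[OF z] c z by auto
      qed
      then show ?thesis by blast
    qed
  next
    case min
    show ?thesis
    proof (cases "k = \<one>")
      case True
      show ?thesis
      proof (cases "u = v")
        case True
        then show ?thesis using \<open>k = \<one>\<close> H_one[of u] by (intro disjI1 conjI bexI[of _ \<one>]) auto
      next
        case False
        have "\<sigma> u (k \<otimes> z) = \<one> \<or> \<sigma> v z = \<one>" if "z \<in> carrier P" for z
          using heads_adj[of u v z] assms that \<open>k = \<one>\<close> False by auto
        then show ?thesis by blast
      qed
    next
      case False
      then obtain w where w: "w \<in> V" "\<sigma> w (inv k) \<noteq> \<one>"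
        using head_exists[of "inv k"] by (auto simp: inv_eq_one)
      then have nw: "w \<noteq> v" "\<not> E v w" using min(2) by blast+
      have "\<sigma> u (k \<otimes> z) = \<one> \<or> \<sigma> v z = \<one>" if "z \<in> carrier P" for z
      proof (rule ccontr)
        assume "\<not> (\<sigma> u (k \<otimes> z) = \<one> \<or> \<sigma> v z = \<one>)"
        then show False
          using minimal_wall_heads[of u k z w] min(1) w nw heads_adj[of v w z] that by auto
      qed
      then show ?thesis by blast
    qed
  qed
qed

lemma walls_nested:
  assumes "u \<in> V" "v \<in> V" "\<not> E u v" "k \<in> carrier P" "h \<in> carrier P"
  obtains (same) c where "u = v" "c \<in> H u" "\<And>z. z \<in> carrier P \<Longrightarrow> \<sigma> u (k \<otimes> z) = c \<otimes> \<sigma> v (h \<otimes> z)"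
  | (nested) \<alpha> \<beta> where "\<And>z. z \<in> carrier P \<Longrightarrow> \<sigma> u (k \<otimes> z) = \<alpha> \<or> \<sigma> v (h \<otimes> z) = \<beta>"
proof -
  have "k \<otimes> inv h \<otimes> (h \<otimes> z) = k \<otimes> z" if "z \<in> carrier P" for z
    using that assms by (simp add: m_assoc)
  then show thesis
    using walls_transverse_or_nested[OF assms(1-3), of "k \<otimes> inv h"] assms same nested
    by (metis inv_closed m_closed)
qed

text \<open>The sectors of \<open>m\<close> cut the group into four quadrants, and the four points
  occupy all of them. Nested or coinciding walls do not allow this.\<close>

lemma crossing_walls_adj:
  assumes "u \<in> V" "v \<in> V" "k \<in> carrier P" "h \<in> carrier P"
    and c: "m \<in> carrier P" "o' \<in> carrier P" "x \<in> carrier P" "y \<in> carrier P"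
    and "\<sigma> u (k \<otimes> m) = \<sigma> u (k \<otimes> y)" "\<sigma> u (k \<otimes> m) \<noteq> \<sigma> u (k \<otimes> o')" "\<sigma> u (k \<otimes> m) \<noteq> \<sigma> u (k \<otimes> x)"
    and "\<sigma> v (h \<otimes> m) = \<sigma> v (h \<otimes> o')" "\<sigma> v (h \<otimes> m) \<noteq> \<sigma> v (h \<otimes> x)" "\<sigma> v (h \<otimes> m) \<noteq> \<sigma> v (h \<otimes> y)"
  shows "E u v"
proof (rule ccontr)
  assume "\<not> E u v"
  from assms(1,2) this assms(3,4) show False
  proof (cases rule: walls_nested)
    case (same d)
    have "\<sigma> v (h \<otimes> m) = \<sigma> v (h \<otimes> y)"
      using same(3)[of m] same(3)[of y] H_carrier[OF same(2)] assms(1-9) by simp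
    then show False using assms by simp
  next
    case (nested \<alpha> \<beta>)
    show False using nested[of m] nested[of o'] nested[of x] nested[of y] assms by metis
  qed
qed

text \<open>Pigeonhole: for nested walls two sectors would cover three points, though each contains
  at most one of them. The condition \<open>u \<noteq> v\<close> excludes coinciding walls.\<close>

lemma triple_walls_adj:
  assumes "u \<in> V" "v \<in> V" "u \<noteq> v" "k \<in> carrier P" "h \<in> carrier P"
    and c: "x \<in> carrier P" "y \<in> carrier P" "z \<in> carrier P"
    and "\<sigma> u (k \<otimes> x) \<noteq> \<sigma> u (k \<otimes> y)" "\<sigma> u (k \<otimes> y) \<noteq> \<sigma> u (k \<otimes> z)" "\<sigma> u (k \<otimes> x) \<noteq> \<sigma> u (k \<otimes> z)"
    and "\<sigma> v (h \<otimes> x) \<noteq> \<sigma> v (h \<otimes> y)" "\<sigma> v (h \<otimes> y) \<noteq> \<sigma> v (h \<otimes> z)" "\<sigma> v (h \<otimes> x) \<noteq> \<sigma> v (h \<otimes> z)"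
  shows "E u v"
proof (rule ccontr)
  assume "\<not> E u v"
  from assms(1,2) this assms(4,5) show False
  proof (cases rule: walls_nested)
    case (same d)
    then show False using assms by simp
  next
    case (nested \<alpha> \<beta>)
    show False using nested[of x] nested[of y] nested[of z] assms by metis
  qed
qed

section \<open>The dual discriminator\<close>

lemma no_common_head:
  assumes "x \<in> carrier P" "y \<in> carrier P" "u \<in> V" "k \<in> carrier P"
    and nc: "\<And>u. u \<in> V \<Longrightarrow> \<sigma> u x = \<sigma> u y \<Longrightarrow> \<sigma> u x = \<one>"
    and "\<sigma> u (k \<otimes> x) = \<sigma> u (k \<otimes> y)"
  shows "\<sigma> u (k \<otimes> x) = \<sigma> u k"
  using assms(4,6)
\<comment> \<open>Letters of the star of \<open>u\<close> in front of \<open>k\<close> translate all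
  heads in question alike and are stripped off. Afterwards a common nontrivial sector gives
  \<open>x\<close> and \<open>y\<close> the heads of \<open>inv k\<close>, or a common head directly
  if \<open>k = \<one>\<close>; both contradict \<open>nc\<close>.\<close>
proof (induction "len k" arbitrary: k rule: less_induct)
  case less
  note [simp] = assms(1-3) less.prems(1)
  show ?case
  proof (cases "\<exists>w\<in>V. (w = u \<or> E u w) \<and> \<sigma> w k \<noteq> \<one>")
    case True
    then obtain w where w: "w \<in> V" "w = u \<or> E u w" "\<sigma> w k \<noteq> \<one>" by blast
    obtain k' where k': "k' \<in> carrier P" "k = \<sigma> w k \<otimes> k'" "len k' < len k"
      by (rule head_split[OF w(1) less.prems(1) w(3)])
    obtain c where c: "c \<in> H u" "\<And>z. z \<in> carrier P \<Longrightarrow> \<sigma> u (\<sigma> w k \<otimes> z) = c \<otimes> \<sigma> u z"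
      using star_translate[of u w "\<sigma> w k"] w head_closed by auto
    have "k \<otimes> z = \<sigma> w k \<otimes> (k' \<otimes> z)" if "z \<in> carrier P" for z
      using k' w that by (metis head_carrier less.prems(1) m_assoc)
    then have *: "\<sigma> u (k \<otimes> z) = c \<otimes> \<sigma> u (k' \<otimes> z)" if "z \<in> carrier P" for z
      using c(2)[of "k' \<otimes> z"] that k' by simp
    then have "c \<otimes> \<sigma> u (k' \<otimes> x) = c \<otimes> \<sigma> u (k' \<otimes> y)"
      using less.prems(2) by simp
    then have "\<sigma> u (k' \<otimes> x) = \<sigma> u (k' \<otimes> y)"
      using H_carrier[OF c(1)] k'(1) by simp
    then have "\<sigma> u (k' \<otimes> x) = \<sigma> u k'" using less.hyps k' by blast
    then show ?thesis using *[of x] *[of \<one>] k'(1) by simp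
  next
    case False
    then have min: "\<And>w. w \<in> V \<Longrightarrow> w = u \<or> E u w \<Longrightarrow> \<sigma> w k = \<one>" by blast
    then have uk: "\<sigma> u k = \<one>" by simp
    show ?thesis
    proof (rule ccontr)
      assume ne: "\<sigma> u (k \<otimes> x) \<noteq> \<sigma> u k"
      then have ne': "\<sigma> u (k \<otimes> x) \<noteq> \<one>" "\<sigma> u (k \<otimes> y) \<noteq> \<one>" using uk less.prems by auto
      have "k \<noteq> \<one>" using nc[of u] less.prems(2) ne' by auto
      then obtain w where w: "w \<in> V" "\<sigma> w (inv k) \<noteq> \<one>"
        using head_exists[of "inv k"] by (auto simp: inv_eq_one)
      have "\<sigma> w x = \<sigma> w (inv k)" "\<sigma> w y = \<sigma> w (inv k)"
        using minimal_wall_heads[of u k _ w] min ne' w by auto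
      then show False using nc[of w] w by simp
    qed
  qed
qed

text \<open>Common heads of \<open>x\<close> and \<open>y\<close> are peeled off until none is left,
  when \<open>no_common_head\<close> shows that \<open>\<one>\<close> has the required values. So
  \<open>p\<close> is the product of the peeled heads.\<close>

lemma discriminator_one:
  assumes "x \<in> carrier P" "y \<in> carrier P"
  shows "\<exists>p\<in>carrier P. \<forall>u\<in>V. \<forall>k\<in>carrier P.
    \<sigma> u (k \<otimes> p) = (if \<sigma> u (k \<otimes> x) = \<sigma> u (k \<otimes> y) then \<sigma> u (k \<otimes> x) else \<sigma> u k)"
  using assms
proof (induction "len x" arbitrary: x y rule: less_induct)
  case less
  note [simp] = less.prems
  show ?case
  proof (cases "\<exists>u\<in>V. \<sigma> u x = \<sigma> u y \<and> \<sigma> u x \<noteq> \<one>")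
    case False
    have "\<sigma> u (k \<otimes> \<one>) = (if \<sigma> u (k \<otimes> x) = \<sigma> u (k \<otimes> y) then \<sigma> u (k \<otimes> x) else \<sigma> u k)"
      if "u \<in> V" "k \<in> carrier P" for u k
      using no_common_head[of x y u k] False that by auto
    then show ?thesis by blast
  next
    case True
    then obtain v where v: "v \<in> V" "\<sigma> v y = \<sigma> v x" "\<sigma> v x \<noteq> \<one>" by auto
    define a where "a = \<sigma> v x"
    have a: "a \<in> H v" "a \<in> carrier P" using v head_closed by (auto simp: a_def)
    obtain x' where x': "x' \<in> carrier P" "x = a \<otimes> x'" "len x' < len x"
      using head_split[OF v(1) less.prems(1) v(3)] a_def by metis
    obtain y' where y': "y' \<in> carrier P" "y = a \<otimes> y'"
      using head_split[of v y] v a_def by (metis less.prems(2))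
    obtain p where p: "p \<in> carrier P" "\<And>u k. u \<in> V \<Longrightarrow> k \<in> carrier P \<Longrightarrow>
        \<sigma> u (k \<otimes> p) = (if \<sigma> u (k \<otimes> x') = \<sigma> u (k \<otimes> y') then \<sigma> u (k \<otimes> x') else \<sigma> u k)"
      using less.hyps[OF x'(3,1) y'(1)] by blast
    have "\<sigma> u (k \<otimes> (a \<otimes> p)) = (if \<sigma> u (k \<otimes> x) = \<sigma> u (k \<otimes> y) then \<sigma> u (k \<otimes> x) else \<sigma> u k)"
      if uk: "u \<in> V" "k \<in> carrier P" for u k
    proof -
      have 1: "\<sigma> u (k \<otimes> (a \<otimes> p)) =
          (if \<sigma> u (k \<otimes> x) = \<sigma> u (k \<otimes> y) then \<sigma> u (k \<otimes> x) else \<sigma> u (k \<otimes> a))"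
        using p(2)[of u "k \<otimes> a"] uk a x' y' p(1) by (simp add: m_assoc)
      \<comment> \<open>Peeling moved the base point from \<open>\<one>\<close> to \<open>a\<close>,
        which matters only on walls separating these two. Such a wall has label \<open>v\<close> and
        its \<open>k\<close> is a syllable of \<open>v\<close> times an element of the link, so it
        reads off the head at \<open>v\<close>, where \<open>x\<close> and \<open>y\<close>
        agree.\<close>
      have "\<sigma> u (k \<otimes> x) = \<sigma> u (k \<otimes> y)" if ne: "\<sigma> u (k \<otimes> a) \<noteq> \<sigma> u k"
      proof -
        have "u = v" using head_mult_right[of k u v a] uk v a ne by auto
        then obtain z where z: "z \<in> gen (link v)" "z \<in> carrier P" "k = \<sigma> v k \<otimes> z"
          using head_mult_right_ne[of k v a] uk a ne by auto
        have "\<sigma> v (k \<otimes> w) = \<sigma> v k \<otimes> \<sigma> v w" if "w \<in> carrier P" for w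
        proof -
          have "k \<otimes> w = \<sigma> v k \<otimes> (z \<otimes> w)"
            using z that v uk by (metis head_carrier m_assoc)
          then show ?thesis using z that v uk by (simp add: head_mult head_closed link_head)
        qed
        then show ?thesis using v \<open>u = v\<close> by simp
      qed
      then show ?thesis using 1 by auto
    qed
    then show ?thesis using a p(1) by (intro bexI[of _ "a \<otimes> p"]) auto
  qed
qed

lemma discriminator:
  assumes "b \<in> carrier P" "x \<in> carrier P" "y \<in> carrier P"
  obtains p where "p \<in> carrier P" "\<And>u k. u \<in> V \<Longrightarrow> k \<in> carrier P \<Longrightarrow>
    \<sigma> u (k \<otimes> p) = (if \<sigma> u (k \<otimes> x) = \<sigma> u (k \<otimes> y) then \<sigma> u (k \<otimes> x) else \<sigma> u (k \<otimes> b))"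
proof -
  obtain p where p: "p \<in> carrier P" "\<And>u k. u \<in> V \<Longrightarrow> k \<in> carrier P \<Longrightarrow>
      \<sigma> u (k \<otimes> p) = (if \<sigma> u (k \<otimes> (inv b \<otimes> x)) = \<sigma> u (k \<otimes> (inv b \<otimes> y))
        then \<sigma> u (k \<otimes> (inv b \<otimes> x)) else \<sigma> u k)"
    using discriminator_one[of "inv b \<otimes> x" "inv b \<otimes> y"] assms by auto
  show thesis
  proof (rule that)
    show "b \<otimes> p \<in> carrier P" using p assms by simp
    fix u k assume "u \<in> V" "k \<in> carrier P"
    then show "\<sigma> u (k \<otimes> (b \<otimes> p)) =
        (if \<sigma> u (k \<otimes> x) = \<sigma> u (k \<otimes> y) then \<sigma> u (k \<otimes> x) else \<sigma> u (k \<otimes> b))"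
      using p(2)[of u "k \<otimes> b"] assms p(1) by (simp add: m_assoc)
  qed
qed

end

section \<open>The electrified word metric\<close>

text \<open>\<open>\<L>\<close> lists the label sets of the coned-off subgroups. The empty set makes
  steps reflexive; the singletons make each vertex-group element a single step.\<close>

locale electrified = head_group P V E H \<sigma> len
  for P :: "('p, 'q) monoid_scheme" (structure) and V :: "'v set" and E H \<sigma> len +
  fixes \<L> :: "'v set set"
  assumes L_sub: "A \<in> \<L> \<Longrightarrow> A \<subseteq> V"
    and L_empty: "{} \<in> \<L>"
    and L_single: "u \<in> V \<Longrightarrow> {u} \<in> \<L>"
begin

text \<open>By \<open>sep_iff_gen\<close> a step is right multiplication by an element of some coned
  \<open>gen A\<close>. In terms of walls it is visibly compatible with translations and
  projections.\<close>

definition estep :: "('p \<times> 'p) set" where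
  "estep = {(x, y). x \<in> carrier P \<and> y \<in> carrier P \<and> (\<exists>A\<in>\<L>. sep x y \<subseteq> A)}"

definition edist :: "'p \<Rightarrow> 'p \<Rightarrow> nat" where
  "edist x y = (LEAST n. (x, y) \<in> estep ^^ n)"

lemma estep_refl: "x \<in> carrier P \<Longrightarrow> (x, x) \<in> estep"
  using L_empty by (auto simp: estep_def sep_self)

lemma estep_sym: "(x, y) \<in> estep \<Longrightarrow> (y, x) \<in> estep"
  unfolding estep_def using sep_sym[of x y] by auto

lemma estep_carrier: "(x, y) \<in> estep \<Longrightarrow> x \<in> carrier P" "(x, y) \<in> estep \<Longrightarrow> y \<in> carrier P"
  by (auto simp: estep_def)

lemma estep_pow_sym: "(x, y) \<in> estep ^^ n \<Longrightarrow> (y, x) \<in> estep ^^ n"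
proof (induction n arbitrary: y)
  case (Suc n)
  then obtain z where "(x, z) \<in> estep ^^ n" "(z, y) \<in> estep" by auto
  then show ?case using relpow_Suc_I2[OF estep_sym Suc.IH] by blast
qed auto

lemma estep_pow_mult_left: "(x, y) \<in> estep ^^ n \<Longrightarrow> g \<in> carrier P \<Longrightarrow> (g \<otimes> x, g \<otimes> y) \<in> estep ^^ n"
proof (induction n arbitrary: y)
  case (Suc n)
  then obtain z where z: "(x, z) \<in> estep ^^ n" "(z, y) \<in> estep" by auto
  then have "(g \<otimes> z, g \<otimes> y) \<in> estep"
    using Suc.prems by (auto simp: estep_def sep_mult_left)
  then show ?case using Suc.IH[OF z(1)] Suc.prems by auto
qed auto

lemma estep_pow_exists:
  assumes "x \<in> carrier P" "y \<in> carrier P"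
  shows "\<exists>n. (x, y) \<in> estep ^^ n"
proof -
  have "\<forall>x\<in>carrier P. \<exists>n. (x, x \<otimes> z) \<in> estep ^^ n" if "z \<in> gen V" for z
    using that subset_refl
  proof (induction rule: gen_induct)
    case one
    show ?case by (auto intro!: exI[of _ 0])
  next
    case (mult u c z)
    show ?case
    proof
      fix x assume x: "x \<in> carrier P"
      have c: "c \<in> carrier P" "z \<in> carrier P" using mult gen_carrier by auto
      then obtain n where "(x \<otimes> c, x \<otimes> c \<otimes> z) \<in> estep ^^ n" using mult.IH x by blast
      moreover have "(x, x \<otimes> c) \<in> estep"
        using x c sep_H[of u c x] mult L_single[of u] by (auto simp: estep_def)
      ultimately have "(x, x \<otimes> c \<otimes> z) \<in> estep ^^ Suc n" by (rule relpow_Suc_I2[rotated])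
      then show "\<exists>n. (x, x \<otimes> (c \<otimes> z)) \<in> estep ^^ n" using x c by (auto simp: m_assoc simp del: relpow.simps)
    qed
  qed
  moreover have "inv x \<otimes> y \<in> gen V"
    using gen_sep[of "inv x \<otimes> y" V] sep_subset assms by auto
  ultimately have "\<exists>n. (x, x \<otimes> (inv x \<otimes> y)) \<in> estep ^^ n" using assms by blast
  then show ?thesis using assms by simp
qed

lemma edist_le: "(x, y) \<in> estep ^^ n \<Longrightarrow> edist x y \<le> n"
  unfolding edist_def by (rule Least_le)

lemma estep_pow_edist: "x \<in> carrier P \<Longrightarrow> y \<in> carrier P \<Longrightarrow> (x, y) \<in> estep ^^ edist x y"
  unfolding edist_def using estep_pow_exists by (metis (mono_tags, lifting) LeastI_ex)

lemma edist_sym: "edist x y = edist y x"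
  unfolding edist_def using estep_pow_sym by metis

lemma edist_triangle:
  "x \<in> carrier P \<Longrightarrow> y \<in> carrier P \<Longrightarrow> z \<in> carrier P \<Longrightarrow> edist x z \<le> edist x y + edist y z"
  by (rule edist_le) (auto simp: relpow_add intro: estep_pow_edist)

lemma edist_self: "edist x x = 0"
  using edist_le[of x x 0] by simp

lemma edist_mult_left:
  assumes "g \<in> carrier P" "x \<in> carrier P" "y \<in> carrier P"
  shows "edist (g \<otimes> x) (g \<otimes> y) = edist x y"
proof (rule antisym)
  show "edist (g \<otimes> x) (g \<otimes> y) \<le> edist x y"
    using assms by (intro edist_le estep_pow_mult_left estep_pow_edist)
  have "edist (inv g \<otimes> (g \<otimes> x)) (inv g \<otimes> (g \<otimes> y)) \<le> edist (g \<otimes> x) (g \<otimes> y)"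
    using assms by (intro edist_le estep_pow_mult_left estep_pow_edist) auto
  then show "edist x y \<le> edist (g \<otimes> x) (g \<otimes> y)" using assms by simp
qed

text \<open>As \<open>u\<close> is adjacent to all of \<open>D\<close>, its vertex group commutes
  with \<open>gen D\<close> and every syllable of \<open>u\<close> can be collected in
  front.\<close>

lemma gen_insert:
  assumes "z \<in> gen (insert u D)" "u \<in> V" "D \<subseteq> V" "\<And>w. w \<in> D \<Longrightarrow> E u w"
  obtains a z' where "a \<in> H u" "z' \<in> gen D" "z = a \<otimes> z'"
proof -
  have "insert u D \<subseteq> V" using assms by auto
  with assms(1) have "\<exists>a\<in>H u. \<exists>z'\<in>gen D. z = a \<otimes> z'"
  proof (induction rule: gen_induct)
    case one
    then show ?case using H_one[OF assms(2)] gen_one by (intro bexI) auto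
  next
    case (mult w c x)
    then obtain a z' where az: "a \<in> H u" "z' \<in> gen D" "x = a \<otimes> z'" by blast
    have car: "a \<in> carrier P" "z' \<in> carrier P" "c \<in> carrier P"
      using az mult gen_carrier assms(2,3) by auto
    show ?case
    proof (cases "w = u")
      case True
      then have "c \<otimes> x = (c \<otimes> a) \<otimes> z'" "c \<otimes> a \<in> H u"
        using az mult car assms(2) by (auto simp: m_assoc H_mult)
      then show ?thesis using az(2) by blast
    next
      case False
      then have w: "w \<in> D" "w \<in> V" using mult assms(3) by auto
      have "a \<otimes> c = c \<otimes> a" using H_commute[of u w a c] assms w mult az by auto
      then have "c \<otimes> x = a \<otimes> (c \<otimes> z')" using az car by (simp add: m_assoc[symmetric])
      moreover have "c \<otimes> z' \<in> gen D" using w mult az by (blast intro: gen_mult gen_incl)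
      ultimately show ?thesis using az(1) by blast
    qed
  qed
  then show thesis using that by blast
qed

text \<open>Each vertex of \<open>B\<close> is adjacent to all other labels, so it splits off as a
  commuting factor at the cost of one step. What is left has labels in
  \<open>A \<subseteq> M\<close> and costs one more.\<close>

lemma clique_steps:
  assumes "finite B" "B \<subseteq> V" "\<And>u w. u \<in> B \<Longrightarrow> w \<in> A \<union> B \<Longrightarrow> w \<noteq> u \<Longrightarrow> E u w" "A \<inter> B = {}"
    and "A \<subseteq> M" "M \<in> \<L>"
    and "x \<in> carrier P" "y \<in> carrier P" "sep x y \<subseteq> A \<union> B"
  shows "(x, y) \<in> estep ^^ Suc (card B)"
  using assms
proof (induction B arbitrary: x rule: finite_induct)
  case empty
  then have "(x, y) \<in> estep" unfolding estep_def by auto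
  then show ?case by simp
next
  case (insert u B)
  let ?D = "A \<union> B"
  have D: "?D \<subseteq> V" using insert.prems(1,4) L_sub[OF insert.prems(5)] by blast
  have "inv x \<otimes> y \<in> gen (insert u ?D)"
    using sep_iff_gen[of x y "insert u ?D"] insert.prems D by auto
  then obtain a z where az: "a \<in> H u" "z \<in> gen ?D" "inv x \<otimes> y = a \<otimes> z"
    using gen_insert[of "inv x \<otimes> y" u ?D] insert D by blast
  have car: "a \<in> carrier P" "z \<in> carrier P" using az insert.prems gen_carrier[OF D] by auto
  have "y = x \<otimes> (inv x \<otimes> y)" using insert.prems by simp
  then have y: "y = x \<otimes> a \<otimes> z" using az(3) car insert.prems by (simp add: m_assoc)
  have "sep (x \<otimes> a) y \<subseteq> ?D"
    using sep_iff_gen[of "x \<otimes> a" y ?D] az(2) y car insert.prems(6) D by simp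
  then have "(x \<otimes> a, y) \<in> estep ^^ Suc (card B)"
    using insert.prems car by (intro insert.IH) auto
  moreover have "(x, x \<otimes> a) \<in> estep"
    using insert.prems car sep_H[of u a x] az(1) L_single[of u] by (auto simp: estep_def)
  ultimately have "(x, y) \<in> estep ^^ Suc (Suc (card B))" by (rule relpow_Suc_I2[rotated])
  then show ?case using insert.hyps by simp
qed

abbreviation K :: nat where
  "K \<equiv> Suc (card V)"

lemma clique_edist:
  assumes "A \<union> B \<subseteq> V" "\<And>u w. u \<in> B \<Longrightarrow> w \<in> A \<union> B \<Longrightarrow> w \<noteq> u \<Longrightarrow> E u w" "A \<inter> B = {}"
    and "A \<subseteq> M" "M \<in> \<L>" "x \<in> carrier P" "y \<in> carrier P" "sep x y \<subseteq> A \<union> B"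
  shows "edist x y \<le> K"
proof -
  have "finite B" "card B \<le> card V"
    using assms(1) finite_V by (auto intro: finite_subset card_mono)
  moreover have "edist x y \<le> Suc (card B)"
    using assms \<open>finite B\<close> by (intro edist_le clique_steps[of B A M]) auto
  ultimately show ?thesis by simp
qed

text \<open>Chooses the point provided by \<open>discriminator\<close>. It serves both as a median
  of three points and, as a function of \<open>x\<close>, as the projection onto the interval
  between \<open>b\<close> and \<open>y\<close>.\<close>

definition med :: "'p \<Rightarrow> 'p \<Rightarrow> 'p \<Rightarrow> 'p" where
  "med b x y = (SOME p. p \<in> carrier P \<and> (\<forall>u\<in>V. \<forall>k\<in>carrier P.
    \<sigma> u (k \<otimes> p) = (if \<sigma> u (k \<otimes> x) = \<sigma> u (k \<otimes> y) then \<sigma> u (k \<otimes> x) else \<sigma> u (k \<otimes> b))))"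

lemma med:
  assumes "b \<in> carrier P" "x \<in> carrier P" "y \<in> carrier P"
  shows "med b x y \<in> carrier P"
    and "u \<in> V \<Longrightarrow> k \<in> carrier P \<Longrightarrow> \<sigma> u (k \<otimes> med b x y) =
      (if \<sigma> u (k \<otimes> x) = \<sigma> u (k \<otimes> y) then \<sigma> u (k \<otimes> x) else \<sigma> u (k \<otimes> b))"
proof -
  obtain p where "p \<in> carrier P \<and> (\<forall>u\<in>V. \<forall>k\<in>carrier P.
    \<sigma> u (k \<otimes> p) = (if \<sigma> u (k \<otimes> x) = \<sigma> u (k \<otimes> y) then \<sigma> u (k \<otimes> x) else \<sigma> u (k \<otimes> b)))"
    using discriminator[OF assms] by metis
  from someI[of "\<lambda>p. p \<in> carrier P \<and> (\<forall>u\<in>V. \<forall>k\<in>carrier P. \<sigma> u (k \<otimes> p) =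
    (if \<sigma> u (k \<otimes> x) = \<sigma> u (k \<otimes> y) then \<sigma> u (k \<otimes> x) else \<sigma> u (k \<otimes> b)))", OF this]
  show "med b x y \<in> carrier P"
    and "u \<in> V \<Longrightarrow> k \<in> carrier P \<Longrightarrow> \<sigma> u (k \<otimes> med b x y) =
      (if \<sigma> u (k \<otimes> x) = \<sigma> u (k \<otimes> y) then \<sigma> u (k \<otimes> x) else \<sigma> u (k \<otimes> b))"
    unfolding med_def by blast+
qed

lemma heads_eq:
  assumes "x \<in> carrier P" "y \<in> carrier P"
    "\<And>u k. u \<in> V \<Longrightarrow> k \<in> carrier P \<Longrightarrow> \<sigma> u (k \<otimes> x) = \<sigma> u (k \<otimes> y)"
  shows "x = y"
  by (rule sep_empty) (use assms in \<open>auto simp: sep_def\<close>)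

text \<open>On each wall the value of \<open>med b x y\<close> depends on \<open>x\<close> only
  through the value of \<open>x\<close> there. Hence projections map steps to steps.\<close>

lemma sep_med:
  assumes "b \<in> carrier P" "x \<in> carrier P" "x' \<in> carrier P" "y \<in> carrier P"
  shows "sep (med b x y) (med b x' y) \<subseteq> sep x x'"
  using assms unfolding sep_def by (auto simp: med) metis

lemma estep_med:
  assumes "b \<in> carrier P" "(x, x') \<in> estep" "y \<in> carrier P"
  shows "(med b x y, med b x' y) \<in> estep"
  using assms sep_med[of b x x' y] by (auto simp: estep_def med)

definition between :: "'p \<Rightarrow> 'p \<Rightarrow> 'p \<Rightarrow> bool" where
  "between x m y \<longleftrightarrow> (\<forall>u\<in>V. \<forall>k\<in>carrier P. \<sigma> u (k \<otimes> m) \<in> {\<sigma> u (k \<otimes> x), \<sigma> u (k \<otimes> y)})"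

lemma edist_chain:
  assumes "\<And>i. i < n \<Longrightarrow> (f i, f (Suc i)) \<in> estep" "i \<le> j" "j \<le> n"
  shows "edist (f i) (f j) \<le> j - i"
proof -
  have "(f i, f j) \<in> estep ^^ (j - i)"
    unfolding relpow_fun_conv using assms by (intro exI[of _ "\<lambda>t. f (i + t)"]) auto
  then show ?thesis by (rule edist_le)
qed

section \<open>Flats over uncovered squares\<close>

text \<open>
  The powers of \<open>\<alpha> \<otimes> \<gamma>\<close> cross a chain of walls labelled alternately by \<open>a\<close> and \<open>c\<close>.
  A step cannot cross two consecutive walls of the chain.
\<close>

lemma alternating_lower_bound:
  assumes V: "a \<in> V" "c \<in> V" "a \<noteq> c" "\<not> E a c" and L: "\<And>A. A \<in> \<L> \<Longrightarrow> \<not> {a, c} \<subseteq> A"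
    and \<alpha>: "\<alpha> \<in> H a" "\<alpha> \<noteq> \<one>" and \<gamma>: "\<gamma> \<in> H c" "\<gamma> \<noteq> \<one>"
    and h: "h \<in> carrier P" "\<sigma> c h = \<one>"
  shows "2 * n \<le> edist \<one> ((\<alpha> \<otimes> \<gamma>) [^] n \<otimes> h)"
proof -
  define l where "l i = (if even i then \<alpha> else \<gamma>)" for i :: nat
  define v where "v i = (if even i then a else c)" for i :: nat
  define pre where "pre = rec_nat \<one> (\<lambda>i p. p \<otimes> l i)"
  have pre: "pre 0 = \<one>" "pre (Suc i) = pre i \<otimes> l i" for i by (simp_all add: pre_def)
  have car: "\<alpha> \<in> carrier P" "\<gamma> \<in> carrier P" using V \<alpha> \<gamma> by auto
  have l: "l i \<in> H (v i)" "l i \<noteq> \<one>" "l i \<in> carrier P" and vV: "v i \<in> V" for i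
    using \<alpha> \<gamma> V car by (auto simp: l_def v_def)
  have pre_c: "pre i \<in> carrier P" for i by (induction i) (auto simp: pre l)
  \<comment> \<open>The wall that the letter \<open>l i\<close>, placed after the prefix
    \<open>pre i\<close>, crosses.\<close>
  define s where "s i z = \<sigma> (v i) (inv (pre i) \<otimes> z)" for i z
  \<comment> \<open>As \<open>a\<close> and \<open>c\<close> are not adjacent, a nontrivial head at
    \<open>v (Suc i)\<close> leaves a trivial one at \<open>v i\<close>, which puts \<open>z\<close>
    into sector \<open>l i\<close> of wall \<open>i\<close>. So the walls are crossed in
    order.\<close>
  have chain: "s i z = l i" if "s (Suc i) z \<noteq> \<one>" "z \<in> carrier P" for i z
  proof -
    let ?y = "inv (pre i) \<otimes> z"
    have y: "?y \<in> carrier P" using that pre_c by simp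
    have "inv (pre (Suc i)) \<otimes> z = inv (l i) \<otimes> ?y"
      using that pre_c l by (simp add: pre inv_mult_group m_assoc)
    then have "\<sigma> (v (Suc i)) (inv (l i) \<otimes> ?y) \<noteq> \<one>" using that(1) by (simp add: s_def)
    moreover have "v (Suc i) \<noteq> v i" "\<not> E (v (Suc i)) (v i)" using V E_sym by (auto simp: v_def)
    ultimately have "\<sigma> (v i) (inv (l i) \<otimes> ?y) = \<one>"
      using heads_adj[of "v (Suc i)" "v i" "inv (l i) \<otimes> ?y"] vV l y by auto
    then have "inv (l i) \<otimes> \<sigma> (v i) ?y = \<one>"
      using head_mult[of "v i" "inv (l i)" ?y] vV l y H_inv by simp
    then have "l i \<otimes> (inv (l i) \<otimes> \<sigma> (v i) ?y) = l i" using l by simp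
    then show ?thesis using l vV y by (simp add: s_def)
  qed
  \<comment> \<open>Walls are counted from \<open>0\<close>, so \<open>k\<close> steps cross at most
    the walls below \<open>k\<close>.\<close>
  have not_crossed: "s k z \<noteq> l k" if "(\<one>, z) \<in> estep ^^ k" for k z
    using that
  proof (induction k arbitrary: z)
    case 0
    then have "z = \<one>" by simp
    then show ?case using l(2)[of 0] vV by (simp add: s_def pre head_one)
  next
    case (Suc k)
    then obtain y where y: "(\<one>, y) \<in> estep ^^ k" "(y, z) \<in> estep" by auto
    then obtain A where A: "A \<in> \<L>" "sep y z \<subseteq> A" "y \<in> carrier P" "z \<in> carrier P"
      by (auto simp: estep_def)
    show ?case
    proof
      assume "s (Suc k) z = l (Suc k)"
      then have 1: "s (Suc k) z \<noteq> \<one>" using l by simp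
      then have 2: "s k z = l k" using chain A by blast
      have 3: "s k y \<noteq> l k" using Suc.IH[OF y(1)] .
      then have 4: "s (Suc k) y = \<one>" using chain A by blast
      have "v i \<in> sep y z" if "s i y \<noteq> s i z" for i
        using that vV pre_c inv_closed unfolding sep_def s_def by blast
      then have "v k \<in> sep y z" "v (Suc k) \<in> sep y z" using 1 2 3 4 by auto
      then have "{a, c} \<subseteq> A" using A(2) by (auto simp: v_def split: if_splits)
      then show False using L[OF A(1)] by blast
    qed
  qed
  show ?thesis
  proof (cases n)
    case (Suc m)
    have "pre (2 * i) = (\<alpha> \<otimes> \<gamma>) [^] i" for i
      using car by (induction i) (auto simp: pre l_def m_assoc)
    then have p: "pre (Suc (Suc (2 * m))) = (\<alpha> \<otimes> \<gamma>) [^] n" using Suc by (metis mult_Suc_right add_2_eq_Suc)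
    let ?z = "(\<alpha> \<otimes> \<gamma>) [^] n \<otimes> h"
    \<comment> \<open>The last of the \<open>2 * n\<close> walls. Since \<open>h\<close> has no head
      at \<open>c\<close>, the final letter \<open>\<gamma>\<close> stays intact and this wall is
      crossed, and by \<open>chain\<close> so are all earlier ones.\<close>
    let ?k = "Suc (2 * m)"
    have z: "?z \<in> carrier P" using car h by simp
    have "inv (pre ?k) \<otimes> ?z = \<gamma> \<otimes> h"
      unfolding p[symmetric] pre(2)[of ?k] using pre_c[of ?k] car h by (simp add: l_def m_assoc)
    then have "s ?k ?z = l ?k"
      using head_mult[of c \<gamma> h] V \<gamma> h car by (simp add: s_def v_def l_def)
    have e: "s j ?z = l j" if "j \<le> ?k" for j
      using that
    proof (induction rule: inc_induct)
      case base
      show ?case by fact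
    next
      case (step j)
      then show ?case using chain[of j ?z] l z by metis
    qed
    have "\<not> edist \<one> ?z \<le> ?k"
      using e[of "edist \<one> ?z"] not_crossed[OF estep_pow_edist[of \<one> ?z]] z by auto
    then show ?thesis using Suc by simp
  qed simp
qed

lemma edist_inv: "y \<in> carrier P \<Longrightarrow> edist \<one> (inv y) = edist \<one> y"
  using edist_mult_left[of y \<one> "inv y"] by (simp add: edist_sym)

lemma edist_mult_le: "x \<in> carrier P \<Longrightarrow> y \<in> carrier P \<Longrightarrow> edist \<one> (x \<otimes> y) \<le> edist \<one> x + edist \<one> y"
  using edist_triangle[of \<one> x "x \<otimes> y"] edist_mult_left[of x \<one> y] by simp

lemma edist_pow_le: "x \<in> carrier P \<Longrightarrow> edist \<one> (x [^] n) \<le> edist \<one> x * n"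
proof (induction n)
  case (Suc n)
  then show ?case using edist_mult_le[of "x [^] n" x] by simp
qed (simp add: edist_self)

lemma edist_H_le: 
  assumes "u \<in> V" "a \<in> H u" shows "edist \<one> a \<le> 1"
proof -
  have "(\<one>, a) \<in> estep"
    using assms sep_H[of u a \<one>] L_single[of u] by (auto simp: estep_def)
  then show ?thesis using edist_le[of \<one> a 1] by simp
qed

lemma commute_pow: "x \<in> carrier P \<Longrightarrow> y \<in> carrier P \<Longrightarrow> x \<otimes> y = y \<otimes> x \<Longrightarrow> x \<otimes> y [^] (n::nat) = y [^] n \<otimes> x"
proof (induction n)
  case (Suc n)
  then have "x \<otimes> (y [^] n \<otimes> y) = y [^] n \<otimes> x \<otimes> y" by (simp flip: m_assoc)
  also have "\<dots> = y [^] n \<otimes> (y \<otimes> x)" using Suc.prems by (simp add: m_assoc)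
  finally show ?case using Suc.prems by (simp add: m_assoc)
qed simp

lemma gen_pow: "x \<in> gen A \<Longrightarrow> x [^] (n::nat) \<in> gen A"
  by (induction n) (simp_all add: gen_one gen_mult)

lemma not_hyperbolic:
  assumes V: "a \<in> V" "b \<in> V" "c \<in> V" "d \<in> V"
    and E: "E a b" "E b c" "E c d" "E d a" "a \<noteq> c" "b \<noteq> d" "\<not> E a c" "\<not> E b d"
    and L: "\<And>A. A \<in> \<L> \<Longrightarrow> \<not> {a, c} \<subseteq> A" "\<And>A. A \<in> \<L> \<Longrightarrow> \<not> {b, d} \<subseteq> A"
    and nontrivial: "\<And>u. u \<in> V \<Longrightarrow> H u \<noteq> {\<one>}"
  shows "\<not> gromov_hyperbolic (carrier P) (\<lambda>x y. real (edist x y))"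
proof
  assume "gromov_hyperbolic (carrier P) (\<lambda>x y. real (edist x y))"
  then obtain \<delta> where "\<forall>w\<in>carrier P. \<forall>x\<in>carrier P. \<forall>y\<in>carrier P. \<forall>z\<in>carrier P.
    gromov_product (\<lambda>x y. real (edist x y)) w x z \<ge>
      min (gromov_product (\<lambda>x y. real (edist x y)) w x y) (gromov_product (\<lambda>x y. real (edist x y)) w y z) - \<delta>"
    unfolding gromov_hyperbolic_def by blast
  \<comment> \<open>The four-point condition without base point: one of the three sums of opposite
    distances is bounded by the larger of the other two, up to \<open>2 * \<delta>\<close>.\<close>
  then have hyp: "real (edist x z) + real (edist y w) \<le>
      max (real (edist x y) + real (edist z w)) (real (edist y z) + real (edist x w)) + 2 * \<delta>"
    if "w \<in> carrier P" "x \<in> carrier P" "y \<in> carrier P" "z \<in> carrier P" for w x y z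
    using that unfolding gromov_product_def by (fastforce simp: field_simps min_def max_def split: if_splits)
  have ex: "\<exists>x\<in>H u. x \<noteq> \<one>" if "u \<in> V" for u
    using nontrivial[OF that] H_one[OF that] by blast
  obtain \<alpha> \<beta> \<gamma> \<epsilon> where el: "\<alpha> \<in> H a" "\<alpha> \<noteq> \<one>" "\<beta> \<in> H b" "\<beta> \<noteq> \<one>" "\<gamma> \<in> H c" "\<gamma> \<noteq> \<one>" "\<epsilon> \<in> H d" "\<epsilon> \<noteq> \<one>"
    using ex V by meson
  have car [simp]: "\<alpha> \<in> carrier P" "\<beta> \<in> carrier P" "\<gamma> \<in> carrier P" "\<epsilon> \<in> carrier P"
    using el V by auto
  obtain n :: nat where n: "3 * \<delta> < real n" using reals_Archimedean2 by blast
  define g where "g = \<alpha> \<otimes> \<gamma>"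
  define h where "h = \<beta> \<otimes> \<epsilon>"
  have gh [simp]: "g \<in> carrier P" "h \<in> carrier P" by (simp_all add: g_def h_def)
  have bd: "{b, d} \<subseteq> V" and ac: "{a, c} \<subseteq> V" using V by auto
  have gen_h: "h [^] m \<in> gen {b, d}" for m :: nat
    unfolding h_def using el(3,7) by (intro gen_pow gen_mult gen_incl[of b] gen_incl[of d]) simp_all
  have gen_g: "g [^] m \<in> gen {a, c}" for m :: nat
    unfolding g_def using el(1,5) by (intro gen_pow gen_mult gen_incl[of a] gen_incl[of c]) simp_all
  have head_trivial: "\<sigma> u z = \<one>" if "z \<in> gen A" "A \<subseteq> V" "u \<in> V" "u \<notin> A" for u z A
  proof -
    have "u \<notin> sep \<one> z" using sep_gen that by blast
    then have "\<sigma> u (\<one> \<otimes> \<one>) = \<sigma> u (\<one> \<otimes> z)" using that(3) unfolding sep_def by blast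
    then show ?thesis using that gen_carrier head_one by simp
  qed
  have "c \<notin> {b, d}" "d \<notin> {a, c}" using E E_irrefl by auto
  then have "\<sigma> c (h [^] n) = \<one>" "\<sigma> c (inv (h [^] n)) = \<one>" "\<sigma> d (g [^] n) = \<one>"
    using head_trivial[OF _ bd, of _ c] head_trivial[OF _ ac, of _ d] gen_h gen_g V
      gen_inv[OF bd] by auto
  then have low: "2 * n \<le> edist \<one> (g [^] n \<otimes> h [^] n)" "2 * n \<le> edist \<one> (g [^] n \<otimes> inv (h [^] n))"
    "2 * (n + n) \<le> edist \<one> (g [^] (n + n))" "2 * (n + n) \<le> edist \<one> (h [^] (n + n))"
    using alternating_lower_bound[of a c \<alpha> \<gamma> "h [^] n" n]
      alternating_lower_bound[of a c \<alpha> \<gamma> "inv (h [^] n)" n]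
      alternating_lower_bound[of a c \<alpha> \<gamma> \<one> "n + n"]
      alternating_lower_bound[of b d \<beta> \<epsilon> \<one> "n + n"] L V E el
    by (simp_all add: g_def[symmetric] h_def[symmetric] head_one del: nat_pow_mult)
  have "edist \<one> g \<le> 2" "edist \<one> h \<le> 2"
    using edist_mult_le[of \<alpha> \<gamma>] edist_mult_le[of \<beta> \<epsilon>] edist_H_le[OF V(1) el(1)]
      edist_H_le[OF V(2) el(3)] edist_H_le[OF V(3) el(5)] edist_H_le[OF V(4) el(7)]
    unfolding g_def h_def by simp_all
  then have up: "edist \<one> (g [^] n) \<le> 2 * n" "edist \<one> (h [^] n) \<le> 2 * n"
    using edist_pow_le[of g n] edist_pow_le[of h n] by (meson gh mult_le_mono1 order_trans)+
  have "\<alpha> \<otimes> h = h \<otimes> \<alpha>" "\<gamma> \<otimes> h = h \<otimes> \<gamma>"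
  proof -
    have "link a \<supseteq> {b, d}" "link c \<supseteq> {b, d}" using V E E_sym by auto
    then have "h [^] (1::nat) \<in> gen (link a)" "h [^] (1::nat) \<in> gen (link c)" using gen_h gen_mono by blast+
    then show "\<alpha> \<otimes> h = h \<otimes> \<alpha>" "\<gamma> \<otimes> h = h \<otimes> \<gamma>"
      using link_commute[of a h \<alpha>] link_commute[of c h \<gamma>] V el by simp_all
  qed
  then have "g \<otimes> h = h \<otimes> g" unfolding g_def by (metis car(1,3) gh(2) m_assoc)
  then have "h [^] n \<otimes> g = g \<otimes> h [^] n" using commute_pow[of g h n] by simp
  then have comm: "h [^] n \<otimes> g [^] n = g [^] n \<otimes> h [^] n" using commute_pow[of "h [^] n" g n] by simp
  define x where "x = g [^] n"
  define y where "y = h [^] n"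
  have xy [simp]: "x \<in> carrier P" "y \<in> carrier P" and comm': "y \<otimes> x = x \<otimes> y"
    using comm by (simp_all add: x_def y_def)
  have d1: "edist z w = edist \<one> (inv z \<otimes> w)" if "z \<in> carrier P" "w \<in> carrier P" for z w
    using edist_mult_left[of "inv z" z w] that by simp
  have i1: "inv x \<otimes> y = y \<otimes> inv x" "inv y \<otimes> x = x \<otimes> inv y"
    using comm' by (metis inv_solve_left inv_solve_right m_assoc m_closed inv_closed xy)+
  define F1 where "F1 = edist \<one> (x \<otimes> y)"
  define F2 where "F2 = edist \<one> (x \<otimes> inv y)"
  have F2': "edist \<one> (inv x \<otimes> y) = F2"
    using edist_inv[of "x \<otimes> inv y"] i1 by (simp add: F2_def inv_mult_group)
  have "inv x \<otimes> inv y = inv y \<otimes> inv x" using inv_mult_group[of x y] inv_mult_group[of y x] comm' by simp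
  then have F1': "edist \<one> (inv x \<otimes> inv y) = F1" "edist \<one> (inv y \<otimes> inv x) = F1"
    using edist_inv[of "x \<otimes> y"] by (simp_all add: F1_def inv_mult_group)
  \<comment> \<open>The parallelogram \<open>\<one>, x, x \<otimes> y, y\<close> has sides at most
    \<open>2 * n\<close>, so its diagonals \<open>F1\<close> and \<open>F2\<close> add up to at most
    \<open>4 * n + 2 * \<delta>\<close>.\<close>
  have "real (edist x y) + real (edist (x \<otimes> y) \<one>) \<le>
      max (real (edist x (x \<otimes> y)) + real (edist y \<one>)) (real (edist (x \<otimes> y) y) + real (edist x \<one>)) + 2 * \<delta>"
    by (rule hyp) simp_all
  moreover have "edist x y = F2" "edist (x \<otimes> y) \<one> = F1" using d1[of x y] F2' by (simp_all add: F1_def edist_sym)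
  moreover have "edist x (x \<otimes> y) = edist \<one> y" "edist (x \<otimes> y) y = edist \<one> x"
    using edist_mult_left[of x \<one> y] edist_mult_left[of y x \<one>] by (simp_all add: comm' edist_sym)
  ultimately have A: "real F1 + real F2 \<le> 4 * real n + 2 * \<delta>"
    using up by (simp add: x_def[symmetric] y_def[symmetric] edist_sym[of _ \<one>])
  \<comment> \<open>The quadrilateral \<open>x, y, inv x, inv y\<close> has diagonals at least
    \<open>4 * n\<close> and sides \<open>F1\<close>, \<open>F2\<close>, so one of these is at least
    \<open>4 * n - \<delta>\<close>.\<close>
  have "real (edist x (inv x)) + real (edist y (inv y)) \<le>
      max (real (edist x y) + real (edist (inv x) (inv y))) (real (edist y (inv x)) + real (edist x (inv y))) + 2 * \<delta>"
    by (rule hyp) simp_all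
  moreover have "edist x (inv x) = edist \<one> (x \<otimes> x)" "edist y (inv y) = edist \<one> (y \<otimes> y)"
    using d1[of x "inv x"] d1[of y "inv y"] edist_inv[of "x \<otimes> x"] edist_inv[of "y \<otimes> y"]
    by (simp_all add: inv_mult_group)
  moreover have "x \<otimes> x = g [^] (n + n)" "y \<otimes> y = h [^] (n + n)"
    by (simp_all add: x_def y_def nat_pow_mult)
  moreover have "edist x y = F2" "edist (inv x) (inv y) = F2" "edist y (inv x) = F1" "edist x (inv y) = F1"
    using d1[of x y] d1[of "inv x" "inv y"] d1[of y "inv x"] d1[of x "inv y"] F1' F2'
    by (simp_all add: F2_def)
  ultimately have B: "8 * real n \<le> max (2 * real F2) (2 * real F1) + 2 * \<delta>"
    using low(3,4) by simp
  \<comment> \<open>The other of the two is at least \<open>2 * n\<close>, so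
    \<open>6 * n - \<delta> \<le> 4 * n + 2 * \<delta>\<close>, against the choice of
    \<open>n\<close>.\<close>
  have "2 * n \<le> F1" "2 * n \<le> F2" using low(1,2) by (simp_all add: F1_def F2_def x_def y_def)
  then show False using A B n by (simp add: max_def split: if_splits)
qed

end

section \<open>Hyperbolicity when squares are covered\<close>

text \<open>The pairs \<open>a, a'\<close> and \<open>b, b'\<close> are the diagonals of an induced
  square. The second assumption is square-completeness of the coned sets, expressed by vertices
  alone.\<close>

locale covered = electrified +
  assumes squares_covered: "a \<in> V \<Longrightarrow> a' \<in> V \<Longrightarrow> b \<in> V \<Longrightarrow> b' \<in> V \<Longrightarrow> a \<noteq> a' \<Longrightarrow> b \<noteq> b' \<Longrightarrow>
      \<not> E a a' \<Longrightarrow> \<not> E b b' \<Longrightarrow> E a b \<Longrightarrow> E a b' \<Longrightarrow> E a' b \<Longrightarrow> E a' b' \<Longrightarrow>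
      \<exists>M\<in>\<L>. {a, a', b, b'} \<subseteq> M"
    and squares_complete: "a \<in> V \<Longrightarrow> a' \<in> V \<Longrightarrow> b \<in> V \<Longrightarrow> b' \<in> V \<Longrightarrow> a \<noteq> a' \<Longrightarrow> b \<noteq> b' \<Longrightarrow>
      \<not> E a a' \<Longrightarrow> \<not> E b b' \<Longrightarrow> E a b \<Longrightarrow> E a b' \<Longrightarrow> E a' b \<Longrightarrow> E a' b' \<Longrightarrow>
      M \<in> \<L> \<Longrightarrow> a \<in> M \<Longrightarrow> a' \<in> M \<Longrightarrow> {b, b'} \<subseteq> M"
begin

text \<open>If neither label set is a clique, nonadjacent pairs from both sides form an induced
  square inside a coned set \<open>M\<close>. Square-completeness draws every label of
  \<open>A\<close> that has a nonneighbour in \<open>A\<close> into \<open>M\<close>, and the rest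
  of \<open>A\<close> is a clique joined to these, so \<open>clique_edist\<close> applies.\<close>

lemma rectangle_thin:
  assumes A: "A \<subseteq> V" and B: "B \<subseteq> V" and AB: "\<And>a b. a \<in> A \<Longrightarrow> b \<in> B \<Longrightarrow> E a b"
    and xy: "x \<in> carrier P" "y \<in> carrier P" "sep x y \<subseteq> A"
    and zw: "z \<in> carrier P" "w \<in> carrier P" "sep z w \<subseteq> B"
  shows "edist x y \<le> K \<or> edist z w \<le> K"
proof -
  define A0 where "A0 = {a \<in> A. \<exists>a'\<in>A. a \<noteq> a' \<and> \<not> E a a'}"
  define B0 where "B0 = {a \<in> B. \<exists>a'\<in>B. a \<noteq> a' \<and> \<not> E a a'}"
  have A0_sub: "A0 \<subseteq> A" and B0_sub: "B0 \<subseteq> B" by (auto simp: A0_def B0_def)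
  have A0: "E u w" if "u \<in> A - A0" "w \<in> A0 \<union> (A - A0)" "w \<noteq> u" for u w
    using that by (auto simp: A0_def)
  have B0: "E u w" if "u \<in> B - B0" "w \<in> B0 \<union> (B - B0)" "w \<noteq> u" for u w
    using that by (auto simp: B0_def)
  consider "A0 = {}" | "B0 = {}" | a b where "a \<in> A0" "b \<in> B0" by blast
  then show ?thesis
  proof cases
    case 1
    then have "edist x y \<le> K"
      by (intro clique_edist[of A0 "A - A0" "{}" x y, OF _ A0 _ _ L_empty xy(1,2)])
        (use A xy(3) A0_sub in blast)+
    then show ?thesis ..
  next
    case 2
    then have "edist z w \<le> K"
      by (intro clique_edist[of B0 "B - B0" "{}" z w, OF _ B0 _ _ L_empty zw(1,2)])
        (use B zw(3) B0_sub in blast)+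
    then show ?thesis ..
  next
    case 3
    then obtain a' b' where ab: "a \<in> A" "a' \<in> A" "a \<noteq> a'" "\<not> E a a'"
      "b \<in> B" "b' \<in> B" "b \<noteq> b'" "\<not> E b b'"
      unfolding A0_def B0_def by blast
    then obtain M where M: "M \<in> \<L>" "{a, a', b, b'} \<subseteq> M"
      using squares_covered[of a a' b b'] A B AB by blast
    have "A0 \<subseteq> M"
    proof
      fix c assume "c \<in> A0"
      then obtain c' where c: "c \<in> A" "c' \<in> A" "c \<noteq> c'" "\<not> E c c'" unfolding A0_def by blast
      then have "{c, c'} \<subseteq> M"
        using M ab A B AB by (intro squares_complete[of b b' c c' M]) (auto intro: E_sym)
      then show "c \<in> M" by blast
    qed
    then have "edist x y \<le> K"
      by (intro clique_edist[of A0 "A - A0" M x y, OF _ A0 _ _ M(1) xy(1,2)])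
        (use A xy(3) A0_sub in blast)+
    then show ?thesis ..
  qed
qed

abbreviation C :: nat where
  "C \<equiv> Suc (2 * K)"

text \<open>
  Along an electrified geodesic from \<open>x\<close> to \<open>y\<close>, project onto the interval between \<open>x\<close> and
  \<open>m\<close> and onto the one between \<open>m\<close> and \<open>y\<close>. The two projections of a point span, together with
  \<open>m\<close>, a rectangle, so that one of them is close to \<open>m\<close>: the geodesic essentially finishes
  the way from \<open>x\<close> to \<open>m\<close> before it starts the one from \<open>m\<close> to \<open>y\<close>.
\<close>

lemma edist_additive:
  assumes car: "x \<in> carrier P" "m \<in> carrier P" "y \<in> carrier P" and between: "between x m y"
  shows "edist x m + edist m y \<le> edist x y + C"
proof -
  define n where "n = edist x y"
  obtain f where f: "f 0 = x" "f n = y" "\<And>i. i < n \<Longrightarrow> (f i, f (Suc i)) \<in> estep"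
    using estep_pow_edist[OF car(1,3)] unfolding relpow_fun_conv n_def by blast
  have fc: "f i \<in> carrier P" if "i \<le> n" for i
    using f estep_carrier(2)[of "f (i - 1)" "f i"] that car by (cases i) auto
  \<comment> \<open>The base points are the outer ends \<open>x\<close> and \<open>y\<close>; this
    makes \<open>p\<close> run from \<open>x\<close> to \<open>m\<close> and \<open>q\<close> from
    \<open>m\<close> to \<open>y\<close>.\<close>
  define p where "p i = med x (f i) m" for i
  define q where "q i = med y (f i) m" for i
  have pc: "p i \<in> carrier P" and qc: "q i \<in> carrier P" if "i \<le> n" for i
    using fc[OF that] car by (simp_all add: p_def q_def med)
  have p_step: "(p i, p (Suc i)) \<in> estep" and q_step: "(q i, q (Suc i)) \<in> estep" if "i < n" for i
    unfolding p_def q_def using f(3)[OF that] car by (auto intro: estep_med)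
  have b: "\<sigma> u (k \<otimes> m) = \<sigma> u (k \<otimes> x) \<or> \<sigma> u (k \<otimes> m) = \<sigma> u (k \<otimes> y)"
    if "u \<in> V" "k \<in> carrier P" for u k
    using between that unfolding between_def by blast
  have ends: "p 0 = x" "q 0 = m" "p n = m" "q n = y"
  proof -
    have 1: "\<sigma> u (k \<otimes> p 0) = \<sigma> u (k \<otimes> x)" "\<sigma> u (k \<otimes> q n) = \<sigma> u (k \<otimes> y)"
      if "u \<in> V" "k \<in> carrier P" for u k
      using that car by (simp_all add: p_def q_def f(1,2) med)
    have 2: "\<sigma> u (k \<otimes> q 0) = \<sigma> u (k \<otimes> m)" "\<sigma> u (k \<otimes> p n) = \<sigma> u (k \<otimes> m)"
      if "u \<in> V" "k \<in> carrier P" for u k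
    proof -
      have "\<sigma> u (k \<otimes> q 0) = (if \<sigma> u (k \<otimes> x) = \<sigma> u (k \<otimes> m) then \<sigma> u (k \<otimes> x) else \<sigma> u (k \<otimes> y))"
        "\<sigma> u (k \<otimes> p n) = (if \<sigma> u (k \<otimes> y) = \<sigma> u (k \<otimes> m) then \<sigma> u (k \<otimes> y) else \<sigma> u (k \<otimes> x))"
        using that car by (simp_all add: p_def q_def f(1,2) med)
      then show "\<sigma> u (k \<otimes> q 0) = \<sigma> u (k \<otimes> m)" "\<sigma> u (k \<otimes> p n) = \<sigma> u (k \<otimes> m)"
        using b[OF that] by metis+
    qed
    show "p 0 = x" "q 0 = m" "p n = m" "q n = y"
      using heads_eq[OF pc[of 0] car(1)] heads_eq[OF qc[of 0] car(2)]
        heads_eq[OF pc[of n] car(2)] heads_eq[OF qc[of n] car(3)] 1 2 by simp_all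
  qed
  have thin: "edist (p i) m \<le> K \<or> edist m (q i) \<le> K" if i: "i \<le> n" for i
  proof (rule rectangle_thin)
    show "sep (p i) m \<subseteq> V" "sep m (q i) \<subseteq> V" by (rule sep_subset)+
    fix u v assume "u \<in> sep (p i) m" "v \<in> sep m (q i)"
    then obtain k h where kh: "u \<in> V" "k \<in> carrier P" "\<sigma> u (k \<otimes> p i) \<noteq> \<sigma> u (k \<otimes> m)"
      "v \<in> V" "h \<in> carrier P" "\<sigma> v (h \<otimes> m) \<noteq> \<sigma> v (h \<otimes> q i)"
      unfolding sep_def by auto
    \<comment> \<open>Relative to \<open>m\<close>, the point \<open>x\<close> lies across the first
      wall only, \<open>y\<close> across the second only, and \<open>f i\<close> across
      both.\<close>
    show "E u v"
    proof (rule crossing_walls_adj[of u v k h m x "f i" y])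
      show "\<sigma> u (k \<otimes> m) = \<sigma> u (k \<otimes> y)" "\<sigma> u (k \<otimes> m) \<noteq> \<sigma> u (k \<otimes> x)"
        "\<sigma> u (k \<otimes> m) \<noteq> \<sigma> u (k \<otimes> f i)"
        using kh(1-3) b[of u k] car fc[OF i] by (auto simp: p_def med split: if_splits)
      show "\<sigma> v (h \<otimes> m) = \<sigma> v (h \<otimes> x)" "\<sigma> v (h \<otimes> m) \<noteq> \<sigma> v (h \<otimes> f i)"
        "\<sigma> v (h \<otimes> m) \<noteq> \<sigma> v (h \<otimes> y)"
        using kh(4-6) b[of v h] car fc[OF i] by (auto simp: q_def med split: if_splits)
    qed (use kh car fc[OF i] in auto)
  qed (use pc[OF i] qc[OF i] car in auto)
  \<comment> \<open>The first time that \<open>p\<close> is near \<open>m\<close>, which exists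
    because \<open>p n = m\<close>. One moment earlier \<open>q\<close> is near \<open>m\<close>;
    this shift is the \<open>Suc\<close> in \<open>C\<close>.\<close>
  define j where "j = (LEAST j. edist (p j) m \<le> K)"
  have j: "edist (p j) m \<le> K" "j \<le> n"
    unfolding j_def using LeastI[of "\<lambda>j. edist (p j) m \<le> K" n] Least_le[of "\<lambda>j. edist (p j) m \<le> K" n]
    by (simp_all add: ends edist_self)
  have xm: "edist x m \<le> j + K"
    using edist_triangle[of x "p j" m] edist_chain[of n p 0 j] p_step pc[OF j(2)] j car ends by simp
  show ?thesis
  proof (cases j)
    case 0
    then show ?thesis using xm edist_triangle[of m x y] car by (simp add: edist_sym[of m x])
  next
    case (Suc i)
    then have "\<not> edist (p i) m \<le> K" using not_less_Least[of i "\<lambda>j. edist (p j) m \<le> K"] j_def by simp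
    then have "edist m (q i) \<le> K" using thin[of i] Suc j(2) by auto
    moreover have "edist (q i) y \<le> n - i"
      using edist_chain[of n q i n] q_step ends Suc j(2) by simp
    ultimately have "edist m y \<le> K + (n - i)"
      using edist_triangle[of m "q i" y] qc[of i] car Suc j(2) by simp
    then show ?thesis using xm Suc j(2) unfolding n_def by simp
  qed
qed

text \<open>The median lies on the intervals from \<open>w\<close> to \<open>x\<close> and from
  \<open>w\<close> to \<open>y\<close>, and within \<open>K\<close> of the one from \<open>x\<close>
  to \<open>y\<close>. By additivity the Gromov product of \<open>x\<close> and \<open>y\<close> at
  \<open>w\<close> is then the distance from \<open>w\<close> to the median, up to a constant; both
  bounds are stated doubled.\<close>

lemma gromov_product_med:
  assumes car: "w \<in> carrier P" "x \<in> carrier P" "y \<in> carrier P"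
  shows "edist w x + edist w y \<le> edist x y + 2 * edist w (med w x y) + 2 * K + C"
    "2 * edist w (med w x y) + edist x y \<le> edist w x + edist w y + 2 * C"
proof -
  let ?m = "med w x y" and ?l = "med x w y"
  note [simp] = car
  have m: "?m \<in> carrier P" and l: "?l \<in> carrier P" by (simp_all add: med)
  have "between w ?m x" "between w ?m y" "between x ?l y"
    unfolding between_def by (auto simp: med)
  then have 1: "edist w ?m + edist ?m x \<le> edist w x + C" "edist w ?m + edist ?m y \<le> edist w y + C"
      "edist x ?l + edist ?l y \<le> edist x y + C"
    using edist_additive m l by auto
  \<comment> \<open>Exchanging the base point of the median matters only on walls that separate
    \<open>w\<close>, \<open>x\<close> and \<open>y\<close> pairwise. By
    \<open>triple_walls_adj\<close> their labels form a clique.\<close>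
  have "edist ?m ?l \<le> K"
  proof (rule clique_edist[of "{}" "sep ?m ?l" "{}"])
    fix u v assume "u \<in> sep ?m ?l" "v \<in> {} \<union> sep ?m ?l" and ne: "v \<noteq> u"
    then obtain k h where kh: "u \<in> V" "k \<in> carrier P" "\<sigma> u (k \<otimes> ?m) \<noteq> \<sigma> u (k \<otimes> ?l)"
      "v \<in> V" "h \<in> carrier P" "\<sigma> v (h \<otimes> ?m) \<noteq> \<sigma> v (h \<otimes> ?l)"
      unfolding sep_def by auto
    show "E u v"
      by (rule triple_walls_adj[of u v k h w x y])
        (use kh ne in \<open>auto simp: med split: if_splits\<close>)
  qed (use m l sep_subset L_empty in auto)
  then have "edist x ?m \<le> edist x ?l + K" "edist ?m y \<le> K + edist ?l y"
    using edist_triangle[of x ?l ?m] edist_triangle[of ?m ?l y] m l edist_sym[of ?m ?l] by auto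
  then show "edist w x + edist w y \<le> edist x y + 2 * edist w ?m + 2 * K + C"
    using 1(3) edist_triangle[of w ?m x] edist_triangle[of w ?m y] m edist_sym[of ?m x] by simp
  show "2 * edist w ?m + edist x y \<le> edist w x + edist w y + 2 * C"
    using 1 edist_triangle[of x ?m y] m edist_sym[of ?m x] by simp
qed

text \<open>The median \<open>r\<close> of \<open>w\<close>, \<open>p\<close> and \<open>q\<close>
  lies between \<open>w\<close> and \<open>s\<close>, which bounds its distance from
  \<open>w\<close>. From \<open>r\<close>, the points \<open>p\<close> and \<open>q\<close> span a
  rectangle, so one of them is close to \<open>r\<close>.\<close>

lemma four_point:
  assumes car: "w \<in> carrier P" "x \<in> carrier P" "y \<in> carrier P" "z \<in> carrier P"
  shows "min (edist w (med w x y)) (edist w (med w y z)) \<le> edist w (med w x z) + K + C"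
proof -
  note [simp] = car
  define p where "p = med w x y"
  define q where "q = med w y z"
  define s where "s = med w x z"
  define r where "r = med w p q"
  have c: "p \<in> carrier P" "q \<in> carrier P" "s \<in> carrier P" "r \<in> carrier P"
    by (simp_all add: p_def q_def s_def r_def med)
  have "between w r s"
    unfolding between_def r_def p_def q_def s_def by (auto simp: med split: if_splits)
  then have 1: "edist w r \<le> edist w s + C" using edist_additive[of w r s] c by simp
  have "edist r p \<le> K \<or> edist r q \<le> K"
  proof (rule rectangle_thin)
    show "sep r p \<subseteq> V" "sep r q \<subseteq> V" by (rule sep_subset)+
    fix u v assume "u \<in> sep r p" "v \<in> sep r q"
    then obtain k h where kh: "u \<in> V" "k \<in> carrier P" "\<sigma> u (k \<otimes> r) \<noteq> \<sigma> u (k \<otimes> p)"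
      "v \<in> V" "h \<in> carrier P" "\<sigma> v (h \<otimes> r) \<noteq> \<sigma> v (h \<otimes> q)"
      unfolding sep_def by auto
    have med_r: "\<sigma> u (k \<otimes> r) = (if \<sigma> u (k \<otimes> p) = \<sigma> u (k \<otimes> q) then \<sigma> u (k \<otimes> p) else \<sigma> u (k \<otimes> w))"
      if "u \<in> V" "k \<in> carrier P" for u k using that c by (simp add: r_def med)
    have med_p: "\<sigma> u (k \<otimes> p) = (if \<sigma> u (k \<otimes> x) = \<sigma> u (k \<otimes> y) then \<sigma> u (k \<otimes> x) else \<sigma> u (k \<otimes> w))"
      if "u \<in> V" "k \<in> carrier P" for u k using that by (simp add: p_def med)
    have med_q: "\<sigma> u (k \<otimes> q) = (if \<sigma> u (k \<otimes> y) = \<sigma> u (k \<otimes> z) then \<sigma> u (k \<otimes> y) else \<sigma> u (k \<otimes> w))"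
      if "u \<in> V" "k \<in> carrier P" for u k using that by (simp add: q_def med)
    \<comment> \<open>Relative to \<open>p\<close>, the point \<open>w\<close> lies across the first
      wall only, \<open>y\<close> across the second only, and \<open>q\<close> across both.\<close>
    show "E u v"
    proof (rule crossing_walls_adj[of u v k h p w q y])
      show "\<sigma> u (k \<otimes> p) = \<sigma> u (k \<otimes> y)" "\<sigma> u (k \<otimes> p) \<noteq> \<sigma> u (k \<otimes> w)"
        "\<sigma> u (k \<otimes> p) \<noteq> \<sigma> u (k \<otimes> q)"
        using kh(3) med_r[OF kh(1,2)] med_p[OF kh(1,2)] by (auto split: if_splits)
      show "\<sigma> v (h \<otimes> p) = \<sigma> v (h \<otimes> w)" "\<sigma> v (h \<otimes> p) \<noteq> \<sigma> v (h \<otimes> q)"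
        "\<sigma> v (h \<otimes> p) \<noteq> \<sigma> v (h \<otimes> y)"
        using kh(6) med_r[OF kh(4,5)] med_p[OF kh(4,5)] med_q[OF kh(4,5)]
        by (auto split: if_splits)
    qed (use kh c in auto)
  qed (use c in auto)
  then show ?thesis
    using 1 edist_triangle[of w r p] edist_triangle[of w r q] c unfolding p_def q_def s_def by auto
qed

lemma gromov_hyperbolic_edist: "gromov_hyperbolic (carrier P) (\<lambda>x y. real (edist x y))"
  unfolding gromov_hyperbolic_def
proof (intro exI ballI)
  fix w x y z assume car: "w \<in> carrier P" "x \<in> carrier P" "y \<in> carrier P" "z \<in> carrier P"
  let ?d = "\<lambda>x y. real (edist x y)"
  have "real (2 * edist w (med w x z) + edist x z) \<le> real (edist w x + edist w z + 2 * C)"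
    using gromov_product_med(2)[of w x z] car by (simp only: of_nat_le_iff)
  then have lower: "real (edist w (med w x z)) \<le> gromov_product ?d w x z + real C"
    unfolding gromov_product_def edist_sym[of x w] edist_sym[of z w] by (simp add: field_simps)
  have upper: "gromov_product ?d w a b \<le> real (edist w (med w a b)) + real K + real C"
    if "a \<in> carrier P" "b \<in> carrier P" for a b
  proof -
    have "real (edist w a + edist w b) \<le> real (edist a b + 2 * edist w (med w a b) + 2 * K + C)"
      using gromov_product_med(1)[of w a b] car that by (simp only: of_nat_le_iff)
    then show ?thesis
      unfolding gromov_product_def edist_sym[of a w] edist_sym[of b w] by simp
  qed
  have "real (edist w (med w x y)) \<le> real (edist w (med w x z)) + real K + real C \<or>
      real (edist w (med w y z)) \<le> real (edist w (med w x z)) + real K + real C"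
    using four_point[OF car] unfolding min_le_iff_disj of_nat_add[symmetric] of_nat_le_iff .
  \<comment> \<open>Adds up the losses: \<open>C\<close> from the lower bound on the Gromov product,
    and \<open>K + C\<close> from each of the upper bound and \<open>four_point\<close>.\<close>
  moreover have "m - (2 * k + 3 * c) \<le> e'" if "e \<le> e' + c" "g \<le> f + k + c" "f \<le> e + k + c" "m \<le> g"
    for m k c e e' f g :: real using that by linarith
  ultimately show "gromov_product ?d w x z \<ge>
      min (gromov_product ?d w x y) (gromov_product ?d w y z) - (2 * real K + 3 * real C)"
    using lower upper[OF car(2,3)] upper[OF car(3,4)] min.cobounded1 min.cobounded2 by blast
qed

end

section \<open>The electrification of a graph product\<close>

lemma gromov_hyperbolic_cong:
  assumes "\<And>x y. x \<in> M \<Longrightarrow> y \<in> M \<Longrightarrow> d x y = d' x y"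
  shows "gromov_hyperbolic M d \<longleftrightarrow> gromov_hyperbolic M d'"
proof -
  have "gromov_product d w x y = gromov_product d' w x y" if "w \<in> M" "x \<in> M" "y \<in> M" for w x y
    using assms that by (simp add: gromov_product_def)
  then show ?thesis unfolding gromov_hyperbolic_def by (simp cong: ball_cong)
qed

text \<open>The graph omits the loops of \<open>R\<close>, so a chain of \<open>R\<close>-steps only
  yields a walk of at most its length. Conversely every walk is a chain, so the minima
  agree.\<close>

lemma graph_dist_eq_Least:
  assumes "\<And>x y. (x, y) \<in> R \<Longrightarrow> x \<in> pverts X \<and> y \<in> pverts X"
    and "parcs X = R - Id" and x: "x \<in> pverts X" and R: "\<exists>n. (x, y) \<in> R ^^ n"
  shows "graph_dist X x y = real (LEAST n. (x, y) \<in> R ^^ n)"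
proof -
  interpret wf_digraph "with_proj X"
    by unfold_locales (use assms in auto)
  have cost: "awalk_cost (\<lambda>_. 1) p = real (length p)" for p
    by (induction p) auto
  have 1: "(x, y) \<in> R ^^ length p" if "awalk x p y" for p
    using that
  proof (induction p arbitrary: x)
    case (Cons e p)
    then have "e \<in> R" "x = fst e" "(snd e, y) \<in> R ^^ length p"
      using assms(2) by (auto simp: awalk_Cons_iff)
    then show ?case using relpow_Suc_I2[of x "snd e" R y "length p"] by simp
  qed (auto simp: awalk_Nil_iff)
  have 2: "\<exists>p. awalk x p y \<and> length p \<le> n" if "(x, y) \<in> R ^^ n" "x \<in> pverts X" for n x
    using that
  proof (induction n arbitrary: x)
    case 0
    then show ?case by (auto simp: awalk_Nil_iff intro!: exI[of _ "[]"])
  next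
    case (Suc n)
    obtain z where z: "(x, z) \<in> R" "(z, y) \<in> R ^^ n" using relpow_Suc_D2[OF Suc.prems(1)] by blast
    then obtain p where p: "awalk z p y" "length p \<le> n" using Suc.IH assms(1) by blast
    show ?case
    proof (cases "x = z")
      case True
      then show ?thesis using p by (auto intro: le_SucI)
    next
      case False
      then have "awalk x ((x, z) # p) y" using p z assms(2) by (simp add: awalk_Cons_iff)
      then show ?thesis using p(2) by (intro exI[of _ "(x, z) # p"]) auto
    qed
  qed
  define m where "m = (LEAST n. (x, y) \<in> R ^^ n)"
  have m: "(x, y) \<in> R ^^ m" using R unfolding m_def by (rule LeastI_ex)
  have "\<mu> (\<lambda>_. 1) x y = ereal (real m)"
  proof (rule antisym)
    obtain p where p: "awalk x p y" "length p \<le> m" using 2[OF m x] by blast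
    then show "\<mu> (\<lambda>_. 1) x y \<le> ereal (real m)"
      using min_cost_le_walk_cost[OF p(1), of "\<lambda>_. 1"] order_trans by (fastforce simp: cost)
    show "ereal (real m) \<le> \<mu> (\<lambda>_. 1) x y"
      unfolding \<mu>_def using 1 by (intro INF_greatest) (auto simp: cost m_def intro: Least_le)
  qed
  then show ?thesis by (simp add: graph_dist_def m_def)
qed

context graph_product_words
begin

section \<open>Heads of elements of the graph product\<close>

lemma el_Cons: "p # w \<in> words \<Longrightarrow> el (p # w) = el [p] \<otimes>\<^bsub>P\<^esub> el w"
  by (subst el_mult) auto

lemma shuffle_words: "w \<approx> w' \<Longrightarrow> w \<in> words \<longleftrightarrow> w' \<in> words"
  by (induction rule: shuffle.induct) auto

lemma el_shuffle: "w \<approx> w' \<Longrightarrow> w \<in> words \<Longrightarrow> el w = el w'"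
proof (induction rule: shuffle.induct)
  case (swap u v a b w)
  interpret group P by (rule group_P)
  have w: "(u, a) # (v, b) # w \<in> words" "(v, b) # (u, a) # w \<in> words" "(v, b) # w \<in> words"
    "(u, a) # w \<in> words" "el [(u, a)] \<in> carrier P" "el [(v, b)] \<in> carrier P" "el w \<in> carrier P"
    using swap by auto
  have "el [(u, a)] \<otimes>\<^bsub>P\<^esub> el [(v, b)] = el [(v, b)] \<otimes>\<^bsub>P\<^esub> el [(u, a)]"
    using el_commute[OF swap(1), of a b] swap by auto
  then show ?case
    unfolding el_Cons[OF w(1)] el_Cons[OF w(2)] el_Cons[OF w(3)] el_Cons[OF w(4)]
    using w(5-7) by (simp flip: m_assoc)
next
  case (cons w w' p)
  then show ?case using shuffle_words[OF cons(1)] by (simp add: el_Cons[of p w] el_Cons[of p w'])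
qed (auto simp: shuffle_words)

lemma el_lmul:
  assumes "u \<in> pverts \<Gamma>" "a \<in> carrier (G u)" "reduced w"
  shows "el (lmul u a w) = el [(u, a)] \<otimes>\<^bsub>P\<^esub> el w"
proof -
  interpret G: group "G u" using assms(1) by (rule group_G)
  interpret group P by (rule group_P)
  let ?h = "vhead u w" and ?r = "vrem u w"
  have h: "?h \<in> carrier (G u)" using assms by (simp add: vhead_closed)
  have r: "?r \<in> words" "w \<in> words" using assms by (simp_all add: reduced_words reduced_vrem)
  have "el w = el [(u, ?h)] \<otimes>\<^bsub>P\<^esub> el ?r"
  proof (cases "?h = \<one>\<^bsub>G u\<^esub>")
    case True
    then show ?thesis using assms r by (simp add: el_one vrem_trivial)
  next
    case False
    then have "el w = el ((u, ?h) # ?r)" using r by (intro el_shuffle shuffle_head_first)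
    then show ?thesis using h r assms by (simp add: el_Cons[of _ ?r])
  qed
  then have "el [(u, a)] \<otimes>\<^bsub>P\<^esub> el w = el [(u, a \<otimes>\<^bsub>G u\<^esub> ?h)] \<otimes>\<^bsub>P\<^esub> el ?r"
    using assms h r by (simp add: m_assoc[symmetric] el_letter_mult)
  also have "\<dots> = el (lmul u a w)"
    using assms h r by (auto simp: lmul_def Let_def el_one el_Cons[of _ ?r])
  finally show ?thesis by simp
qed

lemma el_act: "x \<in> words \<Longrightarrow> el (act x []) = el x"
proof (induction x)
  case (Cons p x)
  then show ?case by (simp add: el_lmul reduced_act el_Cons[of p x])
qed simp

text \<open>An arbitrary word for \<open>g\<close> is reduced by its action on \<open>[]\<close>.
  Only the class modulo shuffling is canonical, by \<open>nf_el\<close>.\<close>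

definition nf :: "('v \<times> 'g) list set set \<Rightarrow> ('v \<times> 'g) list" where
  "nf g = act (SOME x. x \<in> words \<and> el x = g) []"

lemma nf:
  assumes "g \<in> carrier P"
  shows "reduced (nf g)" "el (nf g) = g"
proof -
  have "\<exists>x. x \<in> words \<and> el x = g" using assms by (auto simp: carrier_P)
  then have "(SOME x. x \<in> words \<and> el x = g) \<in> words \<and> el (SOME x. x \<in> words \<and> el x = g) = g"
    by (rule someI_ex)
  then show "reduced (nf g)" "el (nf g) = g"
    unfolding nf_def by (auto simp: reduced_act el_act)
qed

lemma nf_el:
  assumes "x \<in> words" shows "nf (el x) \<approx> act x []"
proof -
  have "act (nf (el x)) [] \<approx> act x []"
    using assms nf[of "el x"] by (intro el_act_cong) (auto intro: reduced_words)
  then show ?thesis using assms nf[of "el x"] by (simp add: act_reduced)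
qed

definition vgroup :: "'v \<Rightarrow> ('v \<times> 'g) list set set set" where
  "vgroup u = (\<lambda>a. el [(u, a)]) ` carrier (G u)"

lemma vertex_group_eq: "vertex_group \<Gamma> G u = vgroup u"
  by (simp add: vertex_group_def vgroup_def Let_def el_def fp_incl_cls)

definition head :: "'v \<Rightarrow> ('v \<times> 'g) list set set \<Rightarrow> ('v \<times> 'g) list set set" where
  "head u g = el [(u, vhead u (nf g))]"

definition nf_length :: "('v \<times> 'g) list set set \<Rightarrow> nat" where
  "nf_length g = length (nf g)"

text \<open>Vertex groups embed: a nontrivial letter turns \<open>[]\<close> into a word of length
  one, which is no shuffle of \<open>[]\<close>.\<close>

lemma el_letter_eq_one:
  assumes "u \<in> pverts \<Gamma>" "a \<in> carrier (G u)" "el [(u, a)] = \<one>\<^bsub>P\<^esub>"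
  shows "a = \<one>\<^bsub>G u\<^esub>"
proof (rule ccontr)
  assume "a \<noteq> \<one>\<^bsub>G u\<^esub>"
  interpret group "G u" using assms(1) by (rule group_G)
  have "act [(u, a)] [] \<approx> act [] []"
    using assms by (intro el_act_cong) (simp_all add: el_Nil)
  then show False using shuffle_length \<open>a \<noteq> _\<close> assms by (fastforce simp: lmul_def)
qed

lemma vhead_nf_closed: "u \<in> pverts \<Gamma> \<Longrightarrow> g \<in> carrier P \<Longrightarrow> vhead u (nf g) \<in> carrier (G u)"
  by (simp add: vhead_closed nf)

lemma head_eq_one:
  "u \<in> pverts \<Gamma> \<Longrightarrow> g \<in> carrier P \<Longrightarrow> head u g = \<one>\<^bsub>P\<^esub> \<longleftrightarrow> vhead u (nf g) = \<one>\<^bsub>G u\<^esub>"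
  unfolding head_def using el_letter_eq_one vhead_nf_closed el_one by metis

lemma nf_letter_mult:
  assumes "u \<in> pverts \<Gamma>" "a \<in> carrier (G u)" "g \<in> carrier P"
  shows "nf (el [(u, a)] \<otimes>\<^bsub>P\<^esub> g) \<approx> lmul u a (nf g)"
proof -
  have r: "reduced (nf g)" "nf g \<in> words" using nf assms(3) reduced_words by auto
  have "el [(u, a)] \<otimes>\<^bsub>P\<^esub> g = el ((u, a) # nf g)"
    using assms r nf(2)[OF assms(3)] by (simp add: el_Cons[of _ "nf g"])
  then show ?thesis using nf_el[of "(u, a) # nf g"] assms r by (simp add: act_reduced)
qed

lemma nf_length_le: "x \<in> words \<Longrightarrow> nf_length (el x) \<le> length x"
  unfolding nf_length_def using shuffle_length[OF nf_el] length_act[of x] by simp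

lemma nf_length_inv_le: "g \<in> carrier P \<Longrightarrow> nf_length (inv\<^bsub>P\<^esub> g) \<le> nf_length g"
  using nf_length_le[of "inv_word (nf g)"] el_inv[of "nf g"] nf reduced_words
  by (simp add: nf_length_def[of g])

lemma vheads_adj:
  "reduced w \<Longrightarrow> u \<noteq> v \<Longrightarrow> vhead u w \<noteq> \<one>\<^bsub>G u\<^esub> \<Longrightarrow> vhead v w \<noteq> \<one>\<^bsub>G v\<^esub> \<Longrightarrow> adj u v"
  by (induction w) (auto split: if_splits dest: adj_sym)

text \<open>On normal forms left multiplication by a letter is \<open>lmul\<close> up to shuffling,
  and both \<open>vhead\<close> and length are invariant under shuffling. So the axioms on heads and
  lengths reduce to facts about reduced words.\<close>

lemma head_group: "head_group P (pverts \<Gamma>) adj vgroup head nf_length"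
proof -
  interpret group P by (rule group_P)
  have inv_letter: "inv\<^bsub>P\<^esub> (el [(u, a)]) = el [(u, inv\<^bsub>G u\<^esub> a)]" if "u \<in> pverts \<Gamma>" "a \<in> carrier (G u)" for u a
    using that el_inv[of "[(u, a)]"] by (simp add: inv_word_def)
  show ?thesis
  proof (intro head_group.intro head_group_axioms.intro)
    show "group P" by (rule group_P)
    show "finite (pverts \<Gamma>)" by (rule finite_verts)
    show "adj u v \<Longrightarrow> adj v u" for u v by (rule adj_sym)
    show "\<not> adj u u" for u by (rule adj_irrefl)
    show "subgroup (vgroup u) P" if u: "u \<in> pverts \<Gamma>" for u
    proof -
      interpret Gu: group "G u" using u by (rule group_G)
      show ?thesis
        by (rule subgroupI)
          (use u in \<open>auto simp: vgroup_def el_letter_mult inv_letter\<close>)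
    qed
    show "a \<otimes>\<^bsub>P\<^esub> b = b \<otimes>\<^bsub>P\<^esub> a"
      if "u \<in> pverts \<Gamma>" "v \<in> pverts \<Gamma>" "adj u v" "a \<in> vgroup u" "b \<in> vgroup v" for u v a b
      using that by (auto simp: vgroup_def el_commute[OF that(3)])
    show "head u x \<in> vgroup u" if "u \<in> pverts \<Gamma>" "x \<in> carrier P" for u x
      using vhead_nf_closed[OF that] by (auto simp: head_def vgroup_def)
    show "head u \<one>\<^bsub>P\<^esub> = \<one>\<^bsub>P\<^esub>" if "u \<in> pverts \<Gamma>" for u
      using shuffle_vhead[OF nf_el[of "[]"], of u] that by (simp add: head_def el_Nil el_one)
    show "head u (a \<otimes>\<^bsub>P\<^esub> x) = a \<otimes>\<^bsub>P\<^esub> head u x"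
      if "u \<in> pverts \<Gamma>" "a \<in> vgroup u" "x \<in> carrier P" for u a x
      using that shuffle_vhead[OF nf_letter_mult[of u _ x], of _ u] nf(1)[OF that(3)]
      by (auto simp: vgroup_def head_def vhead_lmul el_letter_mult vhead_nf_closed)
    show "head u (b \<otimes>\<^bsub>P\<^esub> x) = head u x"
      if "u \<in> pverts \<Gamma>" "v \<in> pverts \<Gamma>" "adj u v" "b \<in> vgroup v" "x \<in> carrier P" for u v b x
      using that shuffle_vhead[OF nf_letter_mult[of v _ x], of _ u]
      by (auto simp: vgroup_def head_def vhead_lmul_adj)
    show "adj u v" if "u \<in> pverts \<Gamma>" "v \<in> pverts \<Gamma>" "u \<noteq> v" "x \<in> carrier P"
      "head u x \<noteq> \<one>\<^bsub>P\<^esub>" "head v x \<noteq> \<one>\<^bsub>P\<^esub>" for u v x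
      using that vheads_adj[of "nf x" u v] by (simp add: nf head_eq_one)
    show "\<exists>u\<in>pverts \<Gamma>. head u x \<noteq> \<one>\<^bsub>P\<^esub>" if x: "x \<in> carrier P" "x \<noteq> \<one>\<^bsub>P\<^esub>" for x
    proof (cases "nf x")
      case Nil
      then show ?thesis using nf(2)[OF x(1)] x(2) by (simp add: el_Nil)
    next
      case (Cons p w)
      then have "fst p \<in> pverts \<Gamma>" "vhead (fst p) (nf x) \<noteq> \<one>\<^bsub>G (fst p)\<^esub>"
        using nf(1)[OF x(1)] by auto
      then show ?thesis using head_eq_one[OF _ x(1)] by blast
    qed
    show "nf_length (inv\<^bsub>P\<^esub> (head u x) \<otimes>\<^bsub>P\<^esub> x) < nf_length x"
      if ux: "u \<in> pverts \<Gamma>" "x \<in> carrier P" "head u x \<noteq> \<one>\<^bsub>P\<^esub>" for u x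
    proof -
      interpret Gu: group "G u" using ux(1) by (rule group_G)
      let ?a = "vhead u (nf x)"
      have a: "?a \<in> carrier (G u)" "?a \<noteq> \<one>\<^bsub>G u\<^esub>"
        using ux by (simp_all add: vhead_nf_closed head_eq_one)
      have "nf (inv\<^bsub>P\<^esub> (head u x) \<otimes>\<^bsub>P\<^esub> x) \<approx> lmul u (inv\<^bsub>G u\<^esub> ?a) (nf x)"
        unfolding head_def inv_letter[OF ux(1) a(1)] using ux a by (intro nf_letter_mult) auto
      also have "lmul u (inv\<^bsub>G u\<^esub> ?a) (nf x) = vrem u (nf x)"
        using a by (simp add: lmul_def)
      finally have "nf_length (inv\<^bsub>P\<^esub> (head u x) \<otimes>\<^bsub>P\<^esub> x) = length (vrem u (nf x))"
        unfolding nf_length_def by (rule shuffle_length)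
      moreover have "length (nf x) = Suc (length (vrem u (nf x)))"
        using shuffle_length[OF shuffle_head_first[OF a(2)]] by simp
      ultimately show ?thesis by (simp add: nf_length_def)
    qed
    show "nf_length (inv\<^bsub>P\<^esub> x) = nf_length x" if "x \<in> carrier P" for x
      using nf_length_inv_le[of x] nf_length_inv_le[of "inv\<^bsub>P\<^esub> x"] that by simp
  qed
qed

section \<open>The electrified metric as a graph distance\<close>

definition coned_sets :: "'v set set" where
  "coned_sets = {{}} \<union> (\<lambda>u. {u}) ` pverts \<Gamma> \<union> {pverts \<Lambda> |\<Lambda>. minsquare \<Lambda> \<Gamma>}"

lemma minsquare_verts: "minsquare \<Lambda> \<Gamma> \<Longrightarrow> pverts \<Lambda> \<subseteq> pverts \<Gamma>"
  by (auto simp: minsquare_def square_complete_with_square_def square_complete_def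
      induced_subgraph_def subgraph_def)

lemma electrified: "electrified P (pverts \<Gamma>) adj vgroup head nf_length coned_sets"
  using head_group minsquare_verts
  by (auto simp: electrified_def electrified_axioms_def coned_sets_def)

sublocale electrified P "pverts \<Gamma>" adj vgroup head nf_length coned_sets
  by (rule electrified)

lemma gen_single: "u \<in> pverts \<Gamma> \<Longrightarrow> gen {u} = vgroup u"
  unfolding gen_def using generate_subgroup_incl[OF subset_refl H_subgroup] by (auto intro: generate.incl)

lemma estep_iff:
  "(g, h) \<in> estep \<longleftrightarrow> g \<in> carrier P \<and> h \<in> carrier P \<and>
    (\<exists>A\<in>coned_sets. inv\<^bsub>P\<^esub> g \<otimes>\<^bsub>P\<^esub> h \<in> gen A)"
proof -
  have "(\<exists>A\<in>coned_sets. sep g h \<subseteq> A) \<longleftrightarrow> (\<exists>A\<in>coned_sets. inv\<^bsub>P\<^esub> g \<otimes>\<^bsub>P\<^esub> h \<in> gen A)"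
    if "g \<in> carrier P" "h \<in> carrier P"
    by (rule bex_cong[OF HOL.refl]) (rule sep_iff_gen[OF that L_sub])
  then show ?thesis unfolding estep_def by blast
qed

lemma gp_subgroup_eq: "gp_subgroup \<Gamma> G \<Lambda> = gen (pverts \<Lambda>)"
  by (simp add: gp_subgroup_def gen_def vertex_group_eq)

text \<open>Both sides describe multiplication by an element of a vertex group or of a minsquare
  subgroup. Steps also allow the identity, which accounts for \<open>Id\<close>, and symmetry of
  \<open>estep\<close> absorbs the two orientations in the Cayley graph.\<close>

lemma electrification_arcs: "parcs (electrification \<Gamma> G) = estep - Id"
proof -
  let ?S = "(\<Union>u\<in>pverts \<Gamma>. vgroup u) \<union> (\<Union>\<Lambda>\<in>{\<Lambda>. minsquare \<Lambda> \<Gamma>}. gen (pverts \<Lambda>))"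
  have 1: "\<exists>A\<in>coned_sets. s \<in> gen A" if "s \<in> ?S" for s
    using that gen_single unfolding coned_sets_def by blast
  have 2: "s \<in> ?S" if "A \<in> coned_sets" "s \<in> gen A" "s \<noteq> \<one>\<^bsub>P\<^esub>" for s A
    using that gen_single gen_empty unfolding coned_sets_def by auto
  have arcs: "parcs (electrification \<Gamma> G) = {(g, h). g \<in> carrier P \<and> h \<in> carrier P \<and> g \<noteq> h \<and>
      (\<exists>s\<in>?S. h = g \<otimes>\<^bsub>P\<^esub> s \<or> g = h \<otimes>\<^bsub>P\<^esub> s)}"
    by (simp add: electrification_def cayley_graph_def vertex_group_eq gp_subgroup_eq)
  have 3: "(g, g \<otimes>\<^bsub>P\<^esub> s) \<in> estep" if s: "s \<in> ?S" and g: "g \<in> carrier P" for g s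
  proof -
    obtain A where A: "A \<in> coned_sets" "s \<in> gen A" using 1 s by blast
    then have "s \<in> carrier P" using gen_carrier L_sub by blast
    then show ?thesis using A g by (auto simp: estep_iff)
  qed
  show ?thesis
  proof (intro equalityI subsetI)
    fix e assume "e \<in> parcs (electrification \<Gamma> G)"
    then obtain g h s where "e = (g, h)" "g \<in> carrier P" "h \<in> carrier P" "g \<noteq> h" "s \<in> ?S"
      "h = g \<otimes>\<^bsub>P\<^esub> s \<or> g = h \<otimes>\<^bsub>P\<^esub> s" unfolding arcs by blast
    then show "e \<in> estep - Id" using 3 estep_sym by auto
  next
    fix e assume e: "e \<in> estep - Id"
    then obtain g h A where gh: "e = (g, h)" "g \<in> carrier P" "h \<in> carrier P" "g \<noteq> h"
      "A \<in> coned_sets" "inv\<^bsub>P\<^esub> g \<otimes>\<^bsub>P\<^esub> h \<in> gen A"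
      by (cases e) (auto simp: estep_iff)
    have "inv\<^bsub>P\<^esub> g \<otimes>\<^bsub>P\<^esub> h \<noteq> \<one>\<^bsub>P\<^esub>"
      using gh(2-4) by (metis inv_equality inv_inv inv_closed)
    then have "inv\<^bsub>P\<^esub> g \<otimes>\<^bsub>P\<^esub> h \<in> ?S" using 2 gh by blast
    moreover have "h = g \<otimes>\<^bsub>P\<^esub> (inv\<^bsub>P\<^esub> g \<otimes>\<^bsub>P\<^esub> h)" using gh by simp
    ultimately show "e \<in> parcs (electrification \<Gamma> G)" unfolding arcs using gh by blast
  qed
qed

lemma electrification_verts: "pverts (electrification \<Gamma> G) = carrier P"
  by (simp add: electrification_def cayley_graph_def)

lemma graph_dist_electrification:
  "x \<in> carrier P \<Longrightarrow> y \<in> carrier P \<Longrightarrow> graph_dist (electrification \<Gamma> G) x y = real (edist x y)"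
  unfolding edist_def using estep_carrier estep_pow_exists
  by (intro graph_dist_eq_Least) (auto simp: electrification_arcs electrification_verts)

lemma hyperbolic_electrification_iff:
  "hyperbolic_graph (electrification \<Gamma> G) \<longleftrightarrow> gromov_hyperbolic (carrier P) (\<lambda>x y. real (edist x y))"
  unfolding hyperbolic_graph_def electrification_verts
  by (rule gromov_hyperbolic_cong) (rule graph_dist_electrification)

section \<open>Induced squares and the two implications\<close>

definition square :: "'v \<Rightarrow> 'v \<Rightarrow> 'v \<Rightarrow> 'v \<Rightarrow> 'v pair_pre_digraph" where
  "square a b c d = \<lparr>pverts = {a, b, c, d},
     parcs = {(a, b), (b, a), (b, c), (c, b), (c, d), (d, c), (d, a), (a, d)}\<rparr>"

lemma wf_graph: "wf_digraph (with_proj \<Gamma>)"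
  by unfold_locales (auto dest: adj_verts)

lemma induced_square_square:
  assumes "a \<noteq> c" "b \<noteq> d" "\<not> adj a c" "\<not> adj b d" "adj a b" "adj b c" "adj c d" "adj d a"
  shows "induced_square (square a b c d) \<Gamma>"
proof -
  have s: "adj b a" "adj c b" "adj d c" "adj a d" "\<not> adj c a" "\<not> adj d b"
    using assms adj_sym by blast+
  have ne: "a \<noteq> b" "b \<noteq> c" "c \<noteq> d" "d \<noteq> a" using assms adj_irrefl by auto
  have wf: "wf_digraph (with_proj (square a b c d))"
    by unfold_locales (auto simp: square_def)
  define Q where "Q = {a, b, c, d}"
  have Q: "pverts (square a b c d) = Q" by (simp add: square_def Q_def)
  have "(x, y) \<in> parcs (square a b c d) \<longleftrightarrow> adj x y" if "x \<in> Q" "y \<in> Q" for x y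
    using that assms s ne adj_irrefl unfolding square_def Q_def by (elim insertE emptyE) simp_all
  moreover have "parcs (square a b c d) \<subseteq> Q \<times> Q" by (auto simp: square_def Q_def)
  ultimately have "parcs (square a b c d) = {e \<in> parcs \<Gamma>. fst e \<in> Q \<and> snd e \<in> Q}" by auto
  moreover have "pverts (square a b c d) \<subseteq> pverts \<Gamma>"
    using assms adj_verts by (auto simp: square_def)
  moreover have "four_cycle (square a b c d)"
    unfolding four_cycle_def
    by (intro exI[of _ a] exI[of _ b] exI[of _ c] exI[of _ d]) (use assms ne in \<open>auto simp: square_def\<close>)
  ultimately show ?thesis
    using wf wf_graph unfolding Q[symmetric]
    by (auto simp: induced_square_def induced_subgraph_def subgraph_def compatible_def)
qed

lemma induced_square_cases:
  assumes "induced_square S \<Gamma>"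
  obtains a b c d where "S = square a b c d" "a \<noteq> c" "b \<noteq> d" "\<not> adj a c" "\<not> adj b d"
    "adj a b" "adj b c" "adj c d" "adj d a"
proof -
  from assms obtain a b c d where *: "distinct [a, b, c, d]" "pverts S = {a, b, c, d}"
     "parcs S = {(a, b), (b, a), (b, c), (c, b), (c, d), (d, c), (d, a), (a, d)}"
    unfolding induced_square_def four_cycle_def by blast
  have "parcs S = {e \<in> parcs \<Gamma>. fst e \<in> pverts S \<and> snd e \<in> pverts S}"
    using assms by (simp add: induced_square_def induced_subgraph_def)
  then have adj: "(x, y) \<in> parcs S \<longleftrightarrow> adj x y" if "x \<in> pverts S" "y \<in> pverts S" for x y
    using that by auto
  show thesis
  proof (rule that[of a b c d])
    show "S = square a b c d" using * by (simp add: square_def)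
    show "\<not> adj a c" "\<not> adj b d" "adj a b" "adj b c" "adj c d" "adj d a"
      using adj[of a c] adj[of b d] adj[of a b] adj[of b c] adj[of c d] adj[of d a] * by auto
  qed (use * in auto)
qed

lemma minsquare_subgraph:
  assumes "minsquare \<Lambda> \<Gamma>" "induced_square S \<Gamma>" "x \<in> pverts S" "y \<in> pverts S" "x \<noteq> y"
    "(x, y) \<notin> parcs S" "x \<in> pverts \<Lambda>" "y \<in> pverts \<Lambda>"
  shows "subgraph (with_proj S) (with_proj \<Lambda>)"
  using assms unfolding minsquare_def square_complete_with_square_def square_complete_def by blast

lemma subgraph_verts: "subgraph (with_proj S) (with_proj \<Lambda>) \<Longrightarrow> pverts S \<subseteq> pverts \<Lambda>"
  by (simp add: subgraph_def)

lemma hyperbolic_if_squares_covered: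
  assumes "\<And>S. induced_square S \<Gamma> \<Longrightarrow>
    \<exists>\<Lambda>. minsquare \<Lambda> \<Gamma> \<and> subgraph (with_proj S) (with_proj \<Lambda>)"
  shows "gromov_hyperbolic (carrier P) (\<lambda>x y. real (edist x y))"
proof -
  interpret covered P "pverts \<Gamma>" adj vgroup head nf_length coned_sets
  proof
    fix a a' b b'
    assume sq: "a \<noteq> a'" "b \<noteq> b'" "\<not> adj a a'" "\<not> adj b b'" "adj a b" "adj a b'" "adj a' b" "adj a' b'"
    then have s: "induced_square (square a b a' b') \<Gamma>"
      by (intro induced_square_square) (auto intro: adj_sym)
    then obtain \<Lambda> where "minsquare \<Lambda> \<Gamma>" "subgraph (with_proj (square a b a' b')) (with_proj \<Lambda>)"
      using assms by blast
    moreover from this(2) have "{a, a', b, b'} \<subseteq> pverts \<Lambda>"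
      using subgraph_verts by (fastforce simp: square_def)
    ultimately show "\<exists>M\<in>coned_sets. {a, a', b, b'} \<subseteq> M"
      unfolding coned_sets_def by blast
    \<comment> \<open>Containing two distinct vertices, \<open>M\<close> can only be the vertex set
      of a minsquare subgraph.\<close>
    fix M assume M: "M \<in> coned_sets" "a \<in> M" "a' \<in> M"
    then obtain \<Lambda> where \<Lambda>: "M = pverts \<Lambda>" "minsquare \<Lambda> \<Gamma>"
      using sq(1) unfolding coned_sets_def by blast
    have "(a, a') \<notin> parcs (square a b a' b')"
      using sq adj_irrefl by (auto simp: square_def)
    then have "subgraph (with_proj (square a b a' b')) (with_proj \<Lambda>)"
      using minsquare_subgraph[OF \<Lambda>(2) s, of a a'] M sq(1) \<Lambda>(1) by (simp add: square_def)
    then show "{b, b'} \<subseteq> M" using subgraph_verts \<Lambda>(1) by (fastforce simp: square_def)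
  qed
  show ?thesis by (rule gromov_hyperbolic_edist)
qed

lemma not_hyperbolic_if_square_uncovered:
  assumes nontriv: "\<And>u. u \<in> pverts \<Gamma> \<Longrightarrow> carrier (G u) \<noteq> {\<one>\<^bsub>G u\<^esub>}"
    and S: "induced_square S \<Gamma>"
    and unc: "\<And>\<Lambda>. minsquare \<Lambda> \<Gamma> \<Longrightarrow> \<not> subgraph (with_proj S) (with_proj \<Lambda>)"
  shows "\<not> gromov_hyperbolic (carrier P) (\<lambda>x y. real (edist x y))"
proof -
  obtain a b c d where S_eq: "S = square a b c d" and sq: "a \<noteq> c" "b \<noteq> d" "\<not> adj a c" "\<not> adj b d"
    "adj a b" "adj b c" "adj c d" "adj d a"
    using induced_square_cases[OF S] by blast
  \<comment> \<open>A coned set with two distinct vertices comes from a minsquare subgraph, and if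
    these are opposite in \<open>S\<close>, square-completeness would put all of \<open>S\<close>
    into it.\<close>
  have opp: "\<not> {x, y} \<subseteq> A"
    if A: "A \<in> coned_sets" and S_xy: "x \<in> pverts S" "y \<in> pverts S" and ne: "x \<noteq> y"
      and "(x, y) \<notin> parcs S" for A x y
  proof
    assume xy: "{x, y} \<subseteq> A"
    then obtain \<Lambda> where "A = pverts \<Lambda>" "minsquare \<Lambda> \<Gamma>"
      using A ne unfolding coned_sets_def by blast
    then show False using minsquare_subgraph[OF _ S, of \<Lambda> x y] that xy unc by blast
  qed
  have ne: "a \<noteq> b" "b \<noteq> c" "c \<noteq> d" "d \<noteq> a" using sq adj_irrefl by auto
  show ?thesis
  proof (rule not_hyperbolic[of a b c d])
    show "\<not> {a, c} \<subseteq> A" "\<not> {b, d} \<subseteq> A" if "A \<in> coned_sets" for A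
      using opp[OF that, of a c] opp[OF that, of b d] sq ne by (auto simp: S_eq square_def)
    show "vgroup u \<noteq> {\<one>\<^bsub>P\<^esub>}" if u: "u \<in> pverts \<Gamma>" for u
    proof
      assume triv: "vgroup u = {\<one>\<^bsub>P\<^esub>}"
      interpret Gu: group "G u" using u by (rule group_G)
      obtain x where "x \<in> carrier (G u)" "x \<noteq> \<one>\<^bsub>G u\<^esub>" using nontriv[OF u] Gu.one_closed by blast
      then show False using el_letter_eq_one[OF u] triv unfolding vgroup_def by blast
    qed
  qed (use sq adj_verts in auto)
qed

end

theorem proposition1p5:
  fixes \<Gamma> :: "'v pair_pre_digraph"
    and G :: "'v \<Rightarrow> ('g, 'm) monoid_scheme"
  assumes "pair_graph \<Gamma>"
    and "\<And>u. u \<in> pverts \<Gamma> \<Longrightarrow> group (G u)"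
    and "\<And>u. u \<in> pverts \<Gamma> \<Longrightarrow> carrier (G u) \<noteq> {\<one>\<^bsub>G u\<^esub>}"
  shows "hyperbolic_graph (electrification \<Gamma> G) \<longleftrightarrow>
    (\<forall>S. induced_square S \<Gamma> \<longrightarrow>
       (\<exists>\<Lambda>. minsquare \<Lambda> \<Gamma> \<and> subgraph (with_proj S) (with_proj \<Lambda>)))"
proof -
  interpret graph_product_words \<Gamma> G
    using assms(1,2) by (rule graph_product_words.intro)
  show ?thesis
    unfolding hyperbolic_electrification_iff
    using hyperbolic_if_squares_covered not_hyperbolic_if_square_uncovered[OF assms(3)] by blast
qed

end
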